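(* Let $\mathbb{F}$ be a field, let $P(\lambda)=\sum_{k=0}^dP_k\lambda^k\in\mathbb{F}[\lambda]^{m\times n}$ (of grade $d$), and let $$\mathcal{L}(\lambda)=\begin{bmatrix}\lambda M_1+M_0 & L_\eta(\lambda)^T\otimes I_m\\ L_\varepsilon(\lambda)\otimes I_n & 0\end{bmatrix}$$ be an $(\varepsilon,n,\eta,m)$-block Kronecker pencil with $\varepsilon+\eta+1=d$. Consider $M_0$ and $M_1$ partitioned into $(\eta+1)\times(\varepsilon+1)$ blocks each of size $m\times n$, and denote these blocks by $[M_0]_{ij},[M_1]_{ij}\in\mathbb{F}^{m\times n}$ for $i=1,\dots,\eta+1$ and $j=1,\dots,\varepsilon+1$. If $$\sum_{i+j=d+2-k}[M_1]_{ij}+\sum_{i+j=d+1-k}[M_0]_{ij}=P_k,\qquad k=0,1,\dots,d,$$ then $\mathcal{L}(\lambda)$ is a strong linearization of $P(\lambda)$, the right minimal indices of $\mathcal{L}(\lambda)$ are those of $P(\lambda)$ shifted by $\varepsilon$, and the left minimal indices of $\mathcal{L}(\lambda)$ are those of $P(\lambda)$ shifted by $\eta$.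
   Context: $L_k(\lambda)\in\mathbb{F}[\lambda]^{k\times(k+1)}$ is the pencil with $-1$ in positions $(i,i)$, $\lambda$ in positions $(i,i+1)$, $i=1,\dots,k$, and zeros elsewhere. $\otimes$ is the Kronecker product. An $(\varepsilon,n,\eta,m)$-block Kronecker pencil is a pencil of the displayed form with $\lambda M_1+M_0$ an arbitrary pencil of size $(\eta+1)m\times(\varepsilon+1)n$. $\varepsilon,\eta\ge 0$ are integers; if $\varepsilon=0$ (resp. $\eta=0$) the second block row (resp. second block column) of $\mathcal{L}(\lambda)$ is absent. In the sums, $(i,j)$ ranges over $1\le i\le\eta+1$, $1\le j\le\varepsilon+1$ (an empty sum is $0$). A matrix polynomial $P(\lambda)$ has grade $d$ if it is written $\sum_{i=0}^dP_i\lambda^i$ (possibly $P_d=0$). $\mathrm{rev}_dP(\lambda):=\lambda^dP(\lambda^{-1})$. A pencil (grade $1$ matrix polynomial) $\mathcal{L}(\lambda)$ is a linearization of $P(\lambda)$ of grade $d$ if for some $s\ge0$ there are unimodular matrix polynomials (nonzero constant determinant) $U(\lambda),V(\lambda)$ with $U(\lambda)\mathcal{L}(\lambda)V(\lambda)=\mathrm{diag}(I_s,P(\lambda))$; it is a strong linearization if moreover $\mathrm{rev}_1\mathcal{L}(\lambda)$ is a linearization of $\mathrm{rev}_dP(\lambda)$. Right (resp. left) minimal indices of an $m\times n$ matrix polynomial $P$: the ordered list of degrees of the vectors in any polynomial basis, of least total degree among polynomial bases, of $\{x\in\mathbb{F}(\lambda)^{n\times1}:Px=0\}$ (resp. $\{y^T\in\mathbb{F}(\lambda)^{1\times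 m}:y^TP=0\}$). "The right (left) minimal indices of $\mathcal{L}$ are those of $P$ shifted by $k$" means: if $\alpha_1\le\cdots\le\alpha_p$ are the right (left) minimal indices of $P$, then $\alpha_1+k\le\cdots\le\alpha_p+k$ are the right (left) minimal indices of $\mathcal{L}$. *)

theory Defs
  imports
    "Jordan_Normal_Form.Matrix_Kernel"
    "HOL-Computational_Algebra.Polynomial_Factorial"
begin

text \<open>Matrix polynomials are matrices over \<^typ>\<open>'a poly\<close>; the field of rational functions is
  \<^typ>\<open>'a poly fract\<close>. Library matrices are indexed from 0, and matrices with no rows or no
  columns are allowed.\<close>

definition has_grade :: "nat \<Rightarrow> 'a::field poly mat \<Rightarrow> bool" where
  "has_grade d P \<longleftrightarrow> (\<forall>i<dim_row P. \<forall>j<dim_col P. degree (P $$ (i, j)) \<le> d)"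

definition coeff_mat :: "'a::field poly mat \<Rightarrow> nat \<Rightarrow> 'a mat" where
  "coeff_mat P k = map_mat (\<lambda>p. coeff p k) P"

text \<open>For \<^term>\<open>has_grade d P\<close> this is \<open>x^d P(1/x)\<close>, computed coefficientwise.\<close>

definition rev_mat :: "nat \<Rightarrow> 'a::field poly mat \<Rightarrow> 'a poly mat" where
  "rev_mat d P = map_mat (\<lambda>p. \<Sum>i\<le>d. monom (coeff p i) (d - i)) P"

definition unimodular :: "'a::field poly mat \<Rightarrow> bool" where
  "unimodular U \<longleftrightarrow> square_mat U \<and> (\<exists>c. c \<noteq> 0 \<and> det U = [:c:])"

definition is_linearization :: "'a::field poly mat \<Rightarrow> 'a poly mat \<Rightarrow> bool" where
  "is_linearization L P \<longleftrightarrow> has_grade 1 L \<and>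
     (\<exists>s. \<exists>U \<in> carrier_mat (dim_row L) (dim_row L). \<exists>V \<in> carrier_mat (dim_col L) (dim_col L).
        unimodular U \<and> unimodular V \<and>
        U * L * V = four_block_mat (1\<^sub>m s) (0\<^sub>m s (dim_col P)) (0\<^sub>m (dim_row P) s) P)"

definition is_strong_linearization :: "nat \<Rightarrow> 'a::field poly mat \<Rightarrow> 'a poly mat \<Rightarrow> bool" where
  "is_strong_linearization d L P \<longleftrightarrow> has_grade d P \<and>
     is_linearization L P \<and> is_linearization (rev_mat 1 L) (rev_mat d P)"

definition right_null_space :: "'a::field poly mat \<Rightarrow> 'a poly fract vec set" where
  "right_null_space P = mat_kernel (map_mat to_fract P)"

definition left_null_space :: "'a::field poly mat \<Rightarrow> 'a poly fract vec set" where
  "left_null_space P = {y \<in> carrier_vec (dim_row P).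
     mat_of_row y * map_mat to_fract P = 0\<^sub>m 1 (dim_col P)}"

text \<open>In the following, \<open>W\<close> is a subspace of the space of vectors of dimension \<open>n\<close> over the
  rational functions.\<close>

definition polynomial_basis ::
    "nat \<Rightarrow> 'a::field poly fract vec set \<Rightarrow> 'a poly vec set \<Rightarrow> bool" where
  "polynomial_basis n W B \<longleftrightarrow> finite B \<and>
     vectorspace.basis class_ring ((module_vec TYPE('a poly fract) n)\<lparr>carrier := W\<rparr>)
       (map_vec to_fract ` B)"

definition vec_degree :: "'a::field poly vec \<Rightarrow> nat" where
  "vec_degree v = (MAX i\<in>{..<dim_vec v}. degree (v $ i))"

definition minimal_basis ::
    "nat \<Rightarrow> 'a::field poly fract vec set \<Rightarrow> 'a poly vec set \<Rightarrow> bool" where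
  "minimal_basis n W B \<longleftrightarrow> polynomial_basis n W B \<and>
     (\<forall>C. polynomial_basis n W C \<longrightarrow> sum vec_degree B \<le> sum vec_degree C)"

text \<open>The description is proper: every subspace has a minimal basis, and all its minimal bases
  have the same ordered list of degrees.\<close>

definition minimal_indices :: "nat \<Rightarrow> 'a::field poly fract vec set \<Rightarrow> nat list" where
  "minimal_indices n W = (THE ds. \<exists>B. minimal_basis n W B \<and>
     ds = sorted_list_of_multiset (image_mset vec_degree (mset_set B)))"

definition right_minimal_indices :: "'a::field poly mat \<Rightarrow> nat list" where
  "right_minimal_indices P = minimal_indices (dim_col P) (right_null_space P)"

definition left_minimal_indices :: "'a::field poly mat \<Rightarrow> nat list" where
  "left_minimal_indices P = minimal_indices (dim_row P) (left_null_space P)"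

definition kronecker_product :: "'a::semiring_0 mat \<Rightarrow> 'a mat \<Rightarrow> 'a mat" (infixl \<open>\<otimes>\<^sub>k\<close> 70) where
  "A \<otimes>\<^sub>k B = mat (dim_row A * dim_row B) (dim_col A * dim_col B)
     (\<lambda>(i, j). A $$ (i div dim_row B, j div dim_col B) * B $$ (i mod dim_row B, j mod dim_col B))"

definition L_pencil :: "nat \<Rightarrow> 'a::field poly mat" where
  "L_pencil k = mat k (k + 1) (\<lambda>(i, j). if j = i then -1 else if j = i + 1 then [:0, 1:] else 0)"

definition pencil :: "'a::field mat \<Rightarrow> 'a mat \<Rightarrow> 'a poly mat" where
  "pencil M1 M0 = [:0, 1:] \<cdot>\<^sub>m map_mat (\<lambda>a. [:a:]) M1 + map_mat (\<lambda>a. [:a:]) M0"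

definition block_kronecker_pencil ::
    "nat \<Rightarrow> nat \<Rightarrow> nat \<Rightarrow> nat \<Rightarrow> 'a::field mat \<Rightarrow> 'a mat \<Rightarrow> 'a poly mat" where
  "block_kronecker_pencil \<epsilon> n \<eta> m M1 M0 = four_block_mat
     (pencil M1 M0)       ((L_pencil \<eta>)\<^sup>T \<otimes>\<^sub>k 1\<^sub>m m)
     (L_pencil \<epsilon> \<otimes>\<^sub>k 1\<^sub>m n)  (0\<^sub>m (\<epsilon> * n) (\<eta> * m))"

text \<open>The block indices \<open>i\<close> and \<open>j\<close> start at 1.\<close>

definition mat_block :: "nat \<Rightarrow> nat \<Rightarrow> 'a mat \<Rightarrow> nat \<Rightarrow> nat \<Rightarrow> 'a mat" where
  "mat_block m n M i j = mat m n (\<lambda>(r, c). M $$ ((i - 1) * m + r, (j - 1) * n + c))"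

text \<open>The type of matrices is not an additive monoid, so the big sum operator does not apply to it.\<close>

definition mat_sum :: "nat \<Rightarrow> nat \<Rightarrow> ('b \<Rightarrow> 'a::comm_monoid_add mat) \<Rightarrow> 'b set \<Rightarrow> 'a mat" where
  "mat_sum m n f S = mat m n (\<lambda>rc. \<Sum>x\<in>S. f x $$ rc)"

definition antidiag_block_sum ::
    "nat \<Rightarrow> nat \<Rightarrow> nat \<Rightarrow> nat \<Rightarrow> 'a::comm_monoid_add mat \<Rightarrow> nat \<Rightarrow> 'a mat" where
  "antidiag_block_sum \<epsilon> n \<eta> m M t = mat_sum m n (\<lambda>(i, j). mat_block m n M i j)
     {(i, j). 1 \<le> i \<and> i \<le> \<eta> + 1 \<and> 1 \<le> j \<and> j \<le> \<epsilon> + 1 \<and> i + j = t}"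

end

theory Submission
  imports Defs "Subresultants.More_Homomorphisms"
begin

text \<open>
  Write \<open>\<Lambda>\<^sub>k = [x\<^sup>k, \<dots>, x, 1]\<^sup>T\<close>. The antidiagonal sum condition says that
  \<open>P = (\<Lambda>\<^sub>\<eta>\<^sup>T \<otimes> I) (x M\<^sub>1 + M\<^sub>0) (\<Lambda>\<^sub>\<epsilon> \<otimes> I)\<close>. The pencil \<open>L\<^sub>k\<close> has a unimodular
  completion \<open>G\<close> with \<open>L\<^sub>k G = [I 0]\<close> and last column \<open>\<Lambda>\<^sub>k\<close>, so multiplying the block Kronecker
  pencil by these completions produces identity blocks that clear everything in the leading block
  except its corner \<open>P\<close>. The reversed pencil is treated in the same way with the reversed column
  \<open>[1, x, \<dots>, x\<^sup>k]\<^sup>T\<close>.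

  A polynomial vector of the right null space of the pencil has the form \<open>[\<Lambda>\<^sub>\<epsilon> \<otimes> u; z]\<close> with
  \<open>P u = 0\<close>, where \<open>u\<close> is arbitrary, \<open>z\<close> is determined by \<open>u\<close>, polynomial, and of degree at most
  \<open>deg u + \<epsilon>\<close>. Hence \<open>u\<close> is recovered by selecting coordinates, and this matches the polynomial
  bases of both null spaces with a shift of all degrees by \<open>\<epsilon>\<close>. That minimal indices are well
  defined follows from a basis exchange: in a minimal basis, every polynomial vector \<open>w\<close> is a
  combination of basis vectors of degree at most \<open>deg w\<close>. The left minimal indices are handled by
  transposition.
\<close>

subsection \<open>Unimodular equivalence\<close>

text \<open>The two determinants multiply to 1, so both are units of the polynomial ring, that is,
  nonzero constants. A one-sided inverse is therefore enough.\<close>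

lemma unimodularI:
  fixes U U' :: "'a::field poly mat"
  assumes U: "U \<in> carrier_mat k k" and U': "U' \<in> carrier_mat k k" and inv: "U * U' = 1\<^sub>m k"
  shows "unimodular U" "unimodular U'"
proof -
  have "det U * det U' = 1"
    using det_mult[OF U U'] inv by simp
  then have "det U dvd 1" "det U' dvd 1"
    by (metis dvd_triv_left, metis dvd_triv_right)
  moreover have "\<exists>c. c \<noteq> 0 \<and> p = [:c:]" if "p dvd 1" for p :: "'a poly"
    using that unfolding is_unit_poly_iff by force
  ultimately show "unimodular U" "unimodular U'"
    using U U' unfolding unimodular_def by auto
qed

lemma unimodular_mult:
  assumes "U \<in> carrier_mat k k" "V \<in> carrier_mat k k" "unimodular U" "unimodular V"
  shows "unimodular (U * V)"
proof -
  obtain a b where "a \<noteq> 0" "det U = [:a:]" "b \<noteq> 0" "det V = [:b:]"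
    using assms by (auto simp: unimodular_def)
  then have "det (U * V) = [:a * b:]" "a * b \<noteq> 0"
    using det_mult[OF assms(1,2)] by simp_all
  then show ?thesis
    using assms unfolding unimodular_def by auto
qed

lemma unimodular_transpose:
  assumes "U \<in> carrier_mat k k" "unimodular U"
  shows "unimodular (U\<^sup>T)"
  using assms by (auto simp: unimodular_def det_transpose)

lemma unimodular_one: "unimodular (1\<^sub>m k :: 'a::field poly mat)"
  by (rule unimodularI[of _ k "1\<^sub>m k"]) auto

lemma unimodular_upper_block:
  fixes U V :: "'a::field poly mat"
  assumes "U \<in> carrier_mat k k" "V \<in> carrier_mat l l" "X \<in> carrier_mat k l"
    and "unimodular U" "unimodular V"
  shows "unimodular (four_block_mat U X (0\<^sub>m l k) V)"
proof -
  obtain a b where "a \<noteq> 0" "det U = [:a:]" "b \<noteq> 0" "det V = [:b:]"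
    using assms by (auto simp: unimodular_def)
  then have "det (four_block_mat U X (0\<^sub>m l k) V) = [:a * b:]" "a * b \<noteq> 0"
    using det_four_block_mat_lower_left_zero[OF assms(1,3) refl assms(2)] by simp_all
  then show ?thesis
    using assms unfolding unimodular_def by auto
qed

lemma unimodular_lower_block:
  fixes U V :: "'a::field poly mat"
  assumes "U \<in> carrier_mat k k" "V \<in> carrier_mat l l" "X \<in> carrier_mat l k"
    and "unimodular U" "unimodular V"
  shows "unimodular (four_block_mat U (0\<^sub>m k l) X V)"
proof -
  obtain a b where "a \<noteq> 0" "det U = [:a:]" "b \<noteq> 0" "det V = [:b:]"
    using assms by (auto simp: unimodular_def)
  then have "det (four_block_mat U (0\<^sub>m k l) X V) = [:a * b:]" "a * b \<noteq> 0"
    using det_four_block_mat_upper_right_zero[OF assms(1) refl assms(3,2)] by simp_all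
  then show ?thesis
    using assms unfolding unimodular_def by auto
qed

text \<open>The inverse is the block swap with \<open>k\<close> and \<open>l\<close> exchanged,
  which avoids computing the sign of the permutation.\<close>

lemma unimodular_block_swap:
  "unimodular (four_block_mat (0\<^sub>m k l) (1\<^sub>m k) (1\<^sub>m l) (0\<^sub>m l k) :: 'a::field poly mat)"
proof (rule unimodularI(1))
  let ?S = "\<lambda>k l. four_block_mat (0\<^sub>m k l) (1\<^sub>m k) (1\<^sub>m l) (0\<^sub>m l k) :: 'a poly mat"
  show "?S k l \<in> carrier_mat (k + l) (k + l)"
    by (intro carrier_matI) simp_all
  show "?S l k \<in> carrier_mat (k + l) (k + l)"
    by (intro carrier_matI) simp_all
  show "?S k l * ?S l k = 1\<^sub>m (k + l)"
    by (subst mult_four_block_mat[where ?nr1.0 = k and ?nr2.0 = l and ?n1.0 = l and ?n2.0 = k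
          and ?nc1.0 = k and ?nc2.0 = l]) auto
qed

text \<open>The transformations are hidden so that elimination steps can be chained with
  \<open>also\<close>. \<open>is_linearization\<close> is this relation with target
  \<open>diag(I, P)\<close>, together with the grade condition.\<close>

definition unimod_equiv :: "'a::field poly mat \<Rightarrow> 'a poly mat \<Rightarrow> bool" where
  "unimod_equiv A B \<longleftrightarrow>
     (\<exists>U \<in> carrier_mat (dim_row A) (dim_row A). \<exists>V \<in> carrier_mat (dim_col A) (dim_col A).
        unimodular U \<and> unimodular V \<and> U * A * V = B)"

lemma unimod_equivI:
  assumes "A \<in> carrier_mat k l" "U \<in> carrier_mat k k" "V \<in> carrier_mat l l"
    and "unimodular U" "unimodular V" "U * A * V = B"
  shows "unimod_equiv A B"
  using assms unfolding unimod_equiv_def by auto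

lemma unimod_equiv_left:
  assumes "A \<in> carrier_mat k l" "U \<in> carrier_mat k k" "unimodular U" "U * A = B"
  shows "unimod_equiv A B"
  using assms by (intro unimod_equivI[of A k l U "1\<^sub>m l"]) (auto simp: unimodular_one)

lemma unimod_equiv_right:
  assumes "A \<in> carrier_mat k l" "V \<in> carrier_mat l l" "unimodular V" "A * V = B"
  shows "unimod_equiv A B"
  using assms by (intro unimod_equivI[of A k l "1\<^sub>m k" V]) (auto simp: unimodular_one)

lemma unimod_equiv_trans [trans]:
  assumes "unimod_equiv A B" "unimod_equiv B C"
  shows "unimod_equiv A C"
proof -
  obtain U V where UV: "U \<in> carrier_mat (dim_row A) (dim_row A)"
    "V \<in> carrier_mat (dim_col A) (dim_col A)" "unimodular U" "unimodular V" "U * A * V = B"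
    using assms(1) unfolding unimod_equiv_def by auto
  then have dims: "dim_row B = dim_row A" "dim_col B = dim_col A"
    by auto
  obtain U' V' where UV': "U' \<in> carrier_mat (dim_row A) (dim_row A)"
    "V' \<in> carrier_mat (dim_col A) (dim_col A)" "unimodular U'" "unimodular V'" "U' * B * V' = C"
    using assms(2) unfolding unimod_equiv_def dims by auto
  have A: "A \<in> carrier_mat (dim_row A) (dim_col A)" by auto
  have "(U' * U) * A * (V * V') = U' * (U * A * V) * V'"
  proof -
    have "(U' * U) * A * (V * V') = (U' * U * A) * V * V'"
      by (rule assoc_mult_mat[symmetric, of _ "dim_row A" "dim_col A" _ "dim_col A" _ "dim_col A"])
        (use UV UV' in auto)
    also have "(U' * U * A) * V = U' * (U * A) * V"
      by (simp only: assoc_mult_mat[OF UV'(1) UV(1) A])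
    also have "\<dots> = U' * (U * A * V)"
      by (rule assoc_mult_mat[OF UV'(1) _ UV(2)]) (use UV in auto)
    finally show ?thesis .
  qed
  then have "(U' * U) * A * (V * V') = C"
    using UV UV' by simp
  then show ?thesis
    using UV UV' by (intro unimod_equivI[OF A, of "U' * U" "V * V'"]) (auto intro: unimodular_mult)
qed

text \<open>With \<open>A\<close> and \<open>B\<close> brought to the form \<open>[I 0]\<close> and \<open>[I; 0]\<close>, these identity blocks clear
  everything in the leading block except its lower right corner.\<close>

lemma unimod_equiv_bordered:
  fixes M A B :: "'a::field poly mat"
  assumes M: "M \<in> carrier_mat (p + m) (q + n)"
    and B: "B \<in> carrier_mat (p + m) p" and A: "A \<in> carrier_mat q (q + n)"
    and U: "U \<in> carrier_mat (p + m) (p + m)" "unimodular U"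
    and V: "V \<in> carrier_mat (q + n) (q + n)" "unimodular V"
    and UB: "U * B = mat (p + m) p (\<lambda>(i, j). if i = j then 1 else 0)"
    and AV: "A * V = mat q (q + n) (\<lambda>(i, j). if i = j then 1 else 0)"
    and P: "mat m n (\<lambda>(i, j). (U * M * V) $$ (p + i, q + j)) = P"
  shows "unimod_equiv (four_block_mat M B A (0\<^sub>m q p))
    (four_block_mat (1\<^sub>m (p + q)) (0\<^sub>m (p + q) n) (0\<^sub>m m (p + q)) P)"
proof -
  define N where "N = U * M * V"
  define B' where "B' = mat (p + m) p (\<lambda>(i, j). if i = j then 1 else 0 :: 'a poly)"
  define A' where "A' = mat q (q + n) (\<lambda>(i, j). if i = j then 1 else 0 :: 'a poly)"
  \<comment> \<open>Adding \<open>Z * A'\<close> clears the first \<open>q\<close> columns of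
    \<open>N\<close> with the identity inside \<open>A'\<close>; adding \<open>B' * T\<close> then
    clears the first \<open>p\<close> rows with the identity inside \<open>B'\<close>.
    \<open>T\<close> vanishes in its first \<open>q\<close> columns because these are already
    cleared. \<open>K\<close> is what remains of \<open>N\<close>.\<close>
  define Z where "Z = mat (p + m) q (\<lambda>(i, j). - N $$ (i, j))"
  define T where "T = mat p (q + n) (\<lambda>(i, j). if j < q then 0 else - N $$ (i, j))"
  define K where "K = mat (p + m) (q + n) (\<lambda>(i, j). if i < p \<or> j < q then 0 else N $$ (i, j))"
  note defs = B'_def A'_def Z_def T_def K_def
  have N: "N \<in> carrier_mat (p + m) (q + n)"
    using M U V by (auto simp: N_def)
  have carr: "B' \<in> carrier_mat (p + m) p" "A' \<in> carrier_mat q (q + n)"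
    "Z \<in> carrier_mat (p + m) q" "T \<in> carrier_mat p (q + n)" "K \<in> carrier_mat (p + m) (q + n)"
    by (auto simp: defs)
  have Pc: "P \<in> carrier_mat m n"
    using P by auto
  have "unimod_equiv (four_block_mat M B A (0\<^sub>m q p)) (four_block_mat N B' A' (0\<^sub>m q p))"
  proof (rule unimod_equivI)
    let ?U = "four_block_mat U (0\<^sub>m (p + m) q) (0\<^sub>m q (p + m)) (1\<^sub>m q)"
    let ?V = "four_block_mat V (0\<^sub>m (q + n) p) (0\<^sub>m p (q + n)) (1\<^sub>m p)"
    show "four_block_mat M B A (0\<^sub>m q p) \<in> carrier_mat (p + m + q) (q + n + p)"
      using M by auto
    show "?U \<in> carrier_mat (p + m + q) (p + m + q)" "?V \<in> carrier_mat (q + n + p) (q + n + p)"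
      using U V by auto
    show "unimodular ?U" "unimodular ?V"
      using U V by (auto intro!: unimodular_upper_block unimodular_one)
    have "?U * four_block_mat M B A (0\<^sub>m q p) =
      four_block_mat (U * M) (U * B) A (0\<^sub>m q p)"
      using U M A B by (subst mult_four_block_mat[of _ "p + m" "p + m" _ q _ q _ _ "q + n" _ p]) auto
    also have "\<dots> * ?V = four_block_mat (U * M * V) (U * B) (A * V) (0\<^sub>m q p)"
      using U V M A B
      by (subst mult_four_block_mat[of _ "p + m" "q + n" _ p _ q _ _ "q + n" _ p]) auto
    finally show "?U * four_block_mat M B A (0\<^sub>m q p) * ?V = four_block_mat N B' A' (0\<^sub>m q p)"
      by (simp add: N_def UB AV B'_def A'_def)
  qed
  also have "unimod_equiv (four_block_mat N B' A' (0\<^sub>m q p)) (four_block_mat K B' A' (0\<^sub>m q p))"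
  proof (rule unimod_equivI)
    let ?U = "four_block_mat (1\<^sub>m (p + m)) Z (0\<^sub>m q (p + m)) (1\<^sub>m q)"
    let ?V = "four_block_mat (1\<^sub>m (q + n)) (0\<^sub>m (q + n) p) T (1\<^sub>m p)"
    show "four_block_mat N B' A' (0\<^sub>m q p) \<in> carrier_mat (p + m + q) (q + n + p)"
      using N carr by auto
    show "?U \<in> carrier_mat (p + m + q) (p + m + q)" "?V \<in> carrier_mat (q + n + p) (q + n + p)"
      using carr by auto
    show "unimodular ?U" "unimodular ?V"
      using carr by (auto intro!: unimodular_upper_block unimodular_lower_block unimodular_one)
    have "?U * four_block_mat N B' A' (0\<^sub>m q p) =
      four_block_mat (N + Z * A') B' A' (0\<^sub>m q p)"
      using N carr by (subst mult_four_block_mat[of _ "p + m" "p + m" _ q _ q _ _ "q + n" _ p])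
        (auto simp: right_add_zero_mat[of _ "p + m" p] left_add_zero_mat[of _ q "q + n"])
    also have "\<dots> * ?V = four_block_mat (N + Z * A' + B' * T) B' A' (0\<^sub>m q p)"
      using N carr
      by (subst mult_four_block_mat[of _ "p + m" "q + n" _ p _ q _ _ "q + n" _ p])
        (auto simp: right_mult_one_mat[of _ q "q + n"] right_mult_one_mat[of _ "p + m" "q + n"]
          left_add_zero_mat[of _ "p + m" p] right_add_zero_mat[of _ q "q + n"])
    also have "N + Z * A' + B' * T = K"
    proof (rule eq_matI)
      fix i j assume "i < dim_row K" "j < dim_col K"
      then have ij: "i < p + m" "j < q + n" by (auto simp: defs)
      have "(Z * A') $$ (i, j) = (\<Sum>k = 0..<q. if k = j then Z $$ (i, k) else 0)"
        using ij by (auto simp: scalar_prod_def A'_def Z_def if_distrib intro!: sum.cong cong: if_cong)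
      then have ZA: "(Z * A') $$ (i, j) = (if j < q then - N $$ (i, j) else 0)"
        using ij by (auto simp: Z_def)
      have "(B' * T) $$ (i, j) = (\<Sum>k = 0..<p. if k = i then T $$ (k, j) else 0)"
        using ij by (auto simp: scalar_prod_def B'_def T_def if_distrib intro!: sum.cong cong: if_cong)
      then have BT: "(B' * T) $$ (i, j) = (if i < p then T $$ (i, j) else 0)"
        by auto
      show "(N + Z * A' + B' * T) $$ (i, j) = K $$ (i, j)"
        using ij N carr ZA BT by (auto simp: K_def T_def)
    qed (auto simp: defs)
    finally show "?U * four_block_mat N B' A' (0\<^sub>m q p) * ?V = four_block_mat K B' A' (0\<^sub>m q p)" .
  qed
  \<comment> \<open>The row swap brings the identity of \<open>A'\<close> to the leading corner; the
    column swap in the next step then moves the identity of \<open>B'\<close> in front of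
    \<open>P\<close>.\<close>
  also have "unimod_equiv (four_block_mat K B' A' (0\<^sub>m q p)) (four_block_mat A' (0\<^sub>m q p) K B')"
  proof (rule unimod_equiv_left)
    let ?S = "four_block_mat (0\<^sub>m q (p + m)) (1\<^sub>m q) (1\<^sub>m (p + m)) (0\<^sub>m (p + m) q)"
    show "four_block_mat K B' A' (0\<^sub>m q p) \<in> carrier_mat (q + (p + m)) (q + n + p)"
      by (intro carrier_matI) (simp_all add: defs)
    show "?S \<in> carrier_mat (q + (p + m)) (q + (p + m))"
      by (intro carrier_matI) simp_all
    show "unimodular ?S"
      by (rule unimodular_block_swap)
    show "?S * four_block_mat K B' A' (0\<^sub>m q p) = four_block_mat A' (0\<^sub>m q p) K B'"
      using carr by (subst mult_four_block_mat[of _ q "p + m" _ q _ "p + m" _ _ "q + n" _ p])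
        (auto simp: left_add_zero_mat[of _ q "q + n"] right_add_zero_mat[of _ "p + m" "q + n"] right_add_zero_mat[of _ "p + m" p])
  qed
  also have "unimod_equiv (four_block_mat A' (0\<^sub>m q p) K B')
    (four_block_mat (1\<^sub>m (p + q)) (0\<^sub>m (p + q) n) (0\<^sub>m m (p + q)) P)"
  proof (rule unimod_equiv_right)
    let ?F = "four_block_mat (0\<^sub>m p n) (1\<^sub>m p) P (0\<^sub>m m p)"
    let ?S = "four_block_mat (0\<^sub>m n p) (1\<^sub>m n) (1\<^sub>m p) (0\<^sub>m p n)"
    let ?V = "four_block_mat (1\<^sub>m q) (0\<^sub>m q (n + p)) (0\<^sub>m (n + p) q) ?S"
    show "four_block_mat A' (0\<^sub>m q p) K B' \<in> carrier_mat (q + (p + m)) (q + (n + p))"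
      by (intro carrier_matI) (simp_all add: defs)
    have S: "?S \<in> carrier_mat (n + p) (n + p)"
      by (intro carrier_matI) simp_all
    then show "?V \<in> carrier_mat (q + (n + p)) (q + (n + p))"
      by auto
    show "unimodular ?V"
      using S by (intro unimodular_upper_block unimodular_one unimodular_block_swap) auto
    have F: "?F \<in> carrier_mat (p + m) (n + p)"
      using Pc by (intro carrier_matI) simp_all
    \<comment> \<open>Only a regrouping: the columns are cut into \<open>q\<close> and
      \<open>n + p\<close> instead of \<open>q + n\<close> and \<open>p\<close>, and
      \<open>K\<close> contributes nothing but its corner \<open>P\<close>.\<close>
    have "four_block_mat A' (0\<^sub>m q p) K B' =
      four_block_mat (1\<^sub>m q) (0\<^sub>m q (n + p)) (0\<^sub>m (p + m) q) ?F"
      using P Pc by (intro eq_matI) (auto simp: defs N_def)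
    also have "\<dots> * ?V = four_block_mat (1\<^sub>m q) (0\<^sub>m q (n + p)) (0\<^sub>m (p + m) q) (?F * ?S)"
      using F S by (subst mult_four_block_mat[of _ q q _ "n + p" _ "p + m" _ _ q _ "n + p"]) 
         (auto simp: left_add_zero_mat[of _ "p + m" "n + p"])
    also have "?F * ?S = four_block_mat (1\<^sub>m p) (0\<^sub>m p n) (0\<^sub>m m p) P"
      using Pc by (subst mult_four_block_mat[of _ p n _ p _ m _ _ p _ n]) auto
    also have "four_block_mat (1\<^sub>m q) (0\<^sub>m q (n + p)) (0\<^sub>m (p + m) q) \<dots> =
      four_block_mat (1\<^sub>m (p + q)) (0\<^sub>m (p + q) n) (0\<^sub>m m (p + q)) P"
      using Pc by (intro eq_matI) (auto simp: add.commute)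
    finally show "four_block_mat A' (0\<^sub>m q p) K B' * ?V =
      four_block_mat (1\<^sub>m (p + q)) (0\<^sub>m (p + q) n) (0\<^sub>m m (p + q)) P" .
  qed
  finally show ?thesis .
qed

subsection \<open>Kronecker products with an identity matrix\<close>

lemma kron_one_dims [simp]:
  "dim_row (A \<otimes>\<^sub>k 1\<^sub>m n) = dim_row A * n" "dim_col (A \<otimes>\<^sub>k 1\<^sub>m n) = dim_col A * n"
  by (simp_all add: kronecker_product_def)

lemma kron_one_index:
  fixes A :: "'a::comm_ring_1 mat"
  assumes "i < dim_row A * n" "j < dim_col A * n"
  shows "(A \<otimes>\<^sub>k 1\<^sub>m n) $$ (i, j) = (if i mod n = j mod n then A $$ (i div n, j div n) else 0)"
proof -
  have "0 < n" using assms by (cases n) auto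
  then show ?thesis
    using assms by (simp add: kronecker_product_def)
qed

text \<open>Indices with a fixed remainder modulo \<open>n\<close> are parametrised by their block
  number. This collapses every sum that involves a factor \<open>A \<otimes> I\<close>.\<close>

lemma block_sum:
  fixes K n r :: nat
  assumes "r < n"
  shows "(\<Sum>k = 0..<K * n. if k mod n = r then f k else 0) = (\<Sum>a = 0..<K. f (a * n + r))"
proof -
  have "(\<Sum>k = 0..<K * n. if k mod n = r then f k else 0)
      = sum f {k \<in> {0..<K * n}. k mod n = r}"
    by (rule sum.inter_filter[symmetric]) simp
  also have "\<dots> = (\<Sum>a = 0..<K. f (a * n + r))"
  proof (rule sum.reindex_bij_witness[of _ "\<lambda>a. a * n + r" "\<lambda>k. k div n"])
    fix a assume "a \<in> {0..<K}"
    then have "Suc a * n \<le> K * n" by (intro mult_right_mono) auto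
    then show "a * n + r \<in> {k \<in> {0..<K * n}. k mod n = r}" using assms by auto
  qed (use assms in \<open>auto simp: less_mult_imp_div_less\<close>)
  finally show ?thesis .
qed

text \<open>The mixed product rule with identity second factors: only the indices \<open>s\<close>
  with \<open>s mod n = i mod n\<close> contribute, so the sum over \<open>s\<close> becomes a sum
  over blocks.\<close>

lemma kron_one_mult:
  fixes A B :: "'a::comm_ring_1 mat"
  assumes A: "A \<in> carrier_mat k l" and B: "B \<in> carrier_mat l h"
  shows "(A \<otimes>\<^sub>k 1\<^sub>m n) * (B \<otimes>\<^sub>k 1\<^sub>m n) = (A * B) \<otimes>\<^sub>k 1\<^sub>m n"
proof (rule eq_matI)
  fix i j assume "i < dim_row ((A * B) \<otimes>\<^sub>k 1\<^sub>m n)" "j < dim_col ((A * B) \<otimes>\<^sub>k 1\<^sub>m n)"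
  then have ij: "i < k * n" "j < h * n" using A B by simp_all
  then have n: "0 < n" by (cases n) auto
  have d: "i div n < k" "j div n < h" using ij by (simp_all add: less_mult_imp_div_less)
  have "((A \<otimes>\<^sub>k 1\<^sub>m n) * (B \<otimes>\<^sub>k 1\<^sub>m n)) $$ (i, j) =
    (\<Sum>s = 0..<l * n. (A \<otimes>\<^sub>k 1\<^sub>m n) $$ (i, s) * (B \<otimes>\<^sub>k 1\<^sub>m n) $$ (s, j))"
    using A B ij by (auto simp: scalar_prod_def)
  also have "\<dots> = (\<Sum>s = 0..<l * n. if s mod n = i mod n then
      A $$ (i div n, s div n) * (if i mod n = j mod n then B $$ (s div n, j div n) else 0) else 0)"
    using A B ij by (auto simp: kron_one_index intro!: sum.cong)
  also have "\<dots> = (\<Sum>a = 0..<l.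
      A $$ (i div n, a) * (if i mod n = j mod n then B $$ (a, j div n) else 0))"
    using n by (subst block_sum) (auto cong: if_cong)
  also have "\<dots> = (if i mod n = j mod n then (A * B) $$ (i div n, j div n) else 0)"
    using A B d by (auto simp: scalar_prod_def)
  also have "\<dots> = ((A * B) \<otimes>\<^sub>k 1\<^sub>m n) $$ (i, j)"
    using A B ij by (simp add: kron_one_index)
  finally show "((A \<otimes>\<^sub>k 1\<^sub>m n) * (B \<otimes>\<^sub>k 1\<^sub>m n)) $$ (i, j) = ((A * B) \<otimes>\<^sub>k 1\<^sub>m n) $$ (i, j)" .
qed (use A B in auto)

text \<open>Rectangular, so as to cover the identity matrix as well as \<open>[I 0]\<close>.\<close>

lemma kron_one_diag:
  "mat k l (\<lambda>(i, j). if i = j then 1 else 0 :: 'a::comm_ring_1) \<otimes>\<^sub>k 1\<^sub>m n =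
    mat (k * n) (l * n) (\<lambda>(i, j). if i = j then 1 else 0)"
proof (rule eq_matI, goal_cases)
  case (1 i j)
  have "i = j \<longleftrightarrow> i div n = j div n \<and> i mod n = j mod n"
    by (metis div_mult_mod_eq)
  then show ?case
    using 1 by (auto simp: kron_one_index less_mult_imp_div_less)
qed auto

lemma kron_one_transpose:
  fixes A :: "'a::comm_ring_1 mat"
  shows "(A \<otimes>\<^sub>k 1\<^sub>m n)\<^sup>T = A\<^sup>T \<otimes>\<^sub>k 1\<^sub>m n"
  by (rule eq_matI) (auto simp: kron_one_index less_mult_imp_div_less)

text \<open>Abstract in \<open>K\<close> and its completion \<open>G\<close>, so that one proof
  serves both the pencil and its reversal. The left inverses \<open>H\<close> provide unimodularity.
  The corner that survives the elimination involves only the last columns of the two completions,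
  which gives the formula for the entries of \<open>P\<close>.\<close>

lemma unimod_equiv_kronecker:
  fixes M :: "'a::field poly mat"
  assumes M: "M \<in> carrier_mat ((\<eta> + 1) * m) ((\<epsilon> + 1) * n)"
    and K\<epsilon>: "K\<epsilon> \<in> carrier_mat \<epsilon> (\<epsilon> + 1)" and K\<eta>: "K\<eta> \<in> carrier_mat \<eta> (\<eta> + 1)"
    and G\<epsilon>: "G\<epsilon> \<in> carrier_mat (\<epsilon> + 1) (\<epsilon> + 1)" and G\<eta>: "G\<eta> \<in> carrier_mat (\<eta> + 1) (\<eta> + 1)"
    and H\<epsilon>: "H\<epsilon> \<in> carrier_mat (\<epsilon> + 1) (\<epsilon> + 1)" and H\<eta>: "H\<eta> \<in> carrier_mat (\<eta> + 1) (\<eta> + 1)"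
    and HG: "H\<epsilon> * G\<epsilon> = 1\<^sub>m (\<epsilon> + 1)" "H\<eta> * G\<eta> = 1\<^sub>m (\<eta> + 1)"
    and KG\<epsilon>: "K\<epsilon> * G\<epsilon> = mat \<epsilon> (\<epsilon> + 1) (\<lambda>(i, j). if i = j then 1 else 0)"
    and KG\<eta>: "K\<eta> * G\<eta> = mat \<eta> (\<eta> + 1) (\<lambda>(i, j). if i = j then 1 else 0)"
    and P: "P \<in> carrier_mat m n" "\<And>r c. r < m \<Longrightarrow> c < n \<Longrightarrow> P $$ (r, c) =
      (\<Sum>a = 0..<\<eta> + 1. \<Sum>b = 0..<\<epsilon> + 1. G\<eta> $$ (a, \<eta>) * M $$ (a * m + r, b * n + c) * G\<epsilon> $$ (b, \<epsilon>))"
  shows "unimod_equiv (four_block_mat M (K\<eta>\<^sup>T \<otimes>\<^sub>k 1\<^sub>m m) (K\<epsilon> \<otimes>\<^sub>k 1\<^sub>m n) (0\<^sub>m (\<epsilon> * n) (\<eta> * m)))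
    (four_block_mat (1\<^sub>m (\<eta> * m + \<epsilon> * n)) (0\<^sub>m (\<eta> * m + \<epsilon> * n) n) (0\<^sub>m m (\<eta> * m + \<epsilon> * n)) P)"
proof (rule unimod_equiv_bordered)
  \<comment> \<open>The upper right border contains a transpose, so the row operations are the
    transpose of a completion.\<close>
  let ?U = "(G\<eta> \<otimes>\<^sub>k 1\<^sub>m m)\<^sup>T" and ?V = "G\<epsilon> \<otimes>\<^sub>k 1\<^sub>m n"
  have dist: "(\<eta> + 1) * m = \<eta> * m + m" "(\<epsilon> + 1) * n = \<epsilon> * n + n" by simp_all
  show M': "M \<in> carrier_mat (\<eta> * m + m) (\<epsilon> * n + n)"
    using M by (simp only: dist)
  show "K\<eta>\<^sup>T \<otimes>\<^sub>k 1\<^sub>m m \<in> carrier_mat (\<eta> * m + m) (\<eta> * m)"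
    "K\<epsilon> \<otimes>\<^sub>k 1\<^sub>m n \<in> carrier_mat (\<epsilon> * n) (\<epsilon> * n + n)"
    using K\<epsilon> K\<eta> by (auto intro!: carrier_matI)
  have G: "G\<eta> \<otimes>\<^sub>k 1\<^sub>m m \<in> carrier_mat (\<eta> * m + m) (\<eta> * m + m)"
    "?V \<in> carrier_mat (\<epsilon> * n + n) (\<epsilon> * n + n)"
    using G\<epsilon> G\<eta> by (auto intro!: carrier_matI)
  then show "?U \<in> carrier_mat (\<eta> * m + m) (\<eta> * m + m)" "?V \<in> carrier_mat (\<epsilon> * n + n) (\<epsilon> * n + n)"
    by auto
  have one: "1\<^sub>m (k + 1) \<otimes>\<^sub>k 1\<^sub>m l = (1\<^sub>m (k * l + l) :: 'a poly mat)" for k l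
  proof -
    have "1\<^sub>m (k + 1) = mat (k + 1) (k + 1) (\<lambda>(i, j). if i = j then 1 else 0 :: 'a poly)" by auto
    then show ?thesis by (simp only: kron_one_diag) auto
  qed
  show "unimodular ?V"
  proof (rule unimodularI(2))
    show "(H\<epsilon> \<otimes>\<^sub>k 1\<^sub>m n) * ?V = 1\<^sub>m (\<epsilon> * n + n)"
      unfolding kron_one_mult[OF H\<epsilon> G\<epsilon>] HG one ..
  qed (use G H\<epsilon> in \<open>auto intro!: carrier_matI\<close>)
  have "unimodular (G\<eta> \<otimes>\<^sub>k 1\<^sub>m m)"
  proof (rule unimodularI(2))
    show "(H\<eta> \<otimes>\<^sub>k 1\<^sub>m m) * (G\<eta> \<otimes>\<^sub>k 1\<^sub>m m) = 1\<^sub>m (\<eta> * m + m)"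
      unfolding kron_one_mult[OF H\<eta> G\<eta>] HG one ..
  qed (use G H\<eta> in \<open>auto intro!: carrier_matI\<close>)
  then show "unimodular ?U"
    using G by (intro unimodular_transpose)
  have "?U * (K\<eta>\<^sup>T \<otimes>\<^sub>k 1\<^sub>m m) = ((K\<eta> \<otimes>\<^sub>k 1\<^sub>m m) * (G\<eta> \<otimes>\<^sub>k 1\<^sub>m m))\<^sup>T"
    unfolding kron_one_transpose[symmetric]
    by (rule transpose_mult[symmetric]) (use G K\<eta> in \<open>auto intro!: carrier_matI\<close>)
  also have "\<dots> = mat (\<eta> * m + m) (\<eta> * m) (\<lambda>(i, j). if i = j then 1 else 0)"
    unfolding kron_one_mult[OF K\<eta> G\<eta>] KG\<eta> kron_one_diag by auto
  finally show "?U * (K\<eta>\<^sup>T \<otimes>\<^sub>k 1\<^sub>m m) = mat (\<eta> * m + m) (\<eta> * m) (\<lambda>(i, j). if i = j then 1 else 0)" .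
  show "(K\<epsilon> \<otimes>\<^sub>k 1\<^sub>m n) * ?V = mat (\<epsilon> * n) (\<epsilon> * n + n) (\<lambda>(i, j). if i = j then 1 else 0)"
    unfolding kron_one_mult[OF K\<epsilon> G\<epsilon>] KG\<epsilon> kron_one_diag dist ..
  show "mat m n (\<lambda>(i, j). (?U * M * ?V) $$ (\<eta> * m + i, \<epsilon> * n + j)) = P"
  proof (rule eq_matI)
    fix r c assume "r < dim_row P" "c < dim_col P"
    then have rc: "r < m" "c < n" using P by auto
    \<comment> \<open>Row \<open>\<eta> * m + r\<close> of \<open>?U\<close> carries column
      \<open>\<eta>\<close> of \<open>G\<eta>\<close>, placed at the positions with remainder
      \<open>r\<close> modulo \<open>m\<close>.\<close>
    have UM: "(?U * M) $$ (\<eta> * m + r, t) = (\<Sum>a = 0..<\<eta> + 1. G\<eta> $$ (a, \<eta>) * M $$ (a * m + r, t))"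
      if t: "t < \<epsilon> * n + n" for t
    proof -
      have "(?U * M) $$ (\<eta> * m + r, t) = (\<Sum>s = 0..<(\<eta> + 1) * m. (G\<eta> \<otimes>\<^sub>k 1\<^sub>m m) $$ (s, \<eta> * m + r) * M $$ (s, t))"
        using M' G\<eta> rc t by (auto simp: scalar_prod_def add.commute[of m])
      also have "\<dots> = (\<Sum>s = 0..<(\<eta> + 1) * m. if s mod m = r then G\<eta> $$ (s div m, \<eta>) * M $$ (s, t) else 0)"
        using G\<eta> rc by (intro sum.cong) (auto simp: kron_one_index)
      also have "\<dots> = (\<Sum>a = 0..<\<eta> + 1. G\<eta> $$ (a, \<eta>) * M $$ (a * m + r, t))"
        using rc by (subst block_sum) auto
      finally show ?thesis .
    qed
    have "(?U * M * ?V) $$ (\<eta> * m + r, \<epsilon> * n + c) =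
        (\<Sum>t = 0..<(\<epsilon> + 1) * n. (?U * M) $$ (\<eta> * m + r, t) * ?V $$ (t, \<epsilon> * n + c))"
      using M' G\<eta> G\<epsilon> rc by (auto simp: scalar_prod_def add.commute[of n])
    also have "\<dots> = (\<Sum>t = 0..<(\<epsilon> + 1) * n. if t mod n = c then
        (\<Sum>a = 0..<\<eta> + 1. G\<eta> $$ (a, \<eta>) * M $$ (a * m + r, t)) * G\<epsilon> $$ (t div n, \<epsilon>) else 0)"
      using G\<epsilon> rc by (intro sum.cong) (auto simp: kron_one_index UM)
    also have "\<dots> = (\<Sum>b = 0..<\<epsilon> + 1.
        (\<Sum>a = 0..<\<eta> + 1. G\<eta> $$ (a, \<eta>) * M $$ (a * m + r, b * n + c)) * G\<epsilon> $$ (b, \<epsilon>))"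
      using rc by (subst block_sum) auto
    also have "\<dots> = P $$ (r, c)"
      unfolding P(2)[OF rc] sum_distrib_right by (rule sum.swap)
    finally show "mat m n (\<lambda>(i, j). (?U * M * ?V) $$ (\<eta> * m + i, \<epsilon> * n + j)) $$ (r, c) = P $$ (r, c)"
      using rc by simp
  qed (use P in auto)
qed

section \<open>Unimodular completions of \<open>L_k\<close> and of its reversal\<close>

text \<open>Upper triangular with diagonal entries 1 or -1. The last column
  \<open>[x^k, ..., x, 1]\<close> spans the null space of \<open>L_k\<close>; the other columns form
  a right inverse of \<open>L_k\<close>.\<close>

definition L_completion :: "nat \<Rightarrow> 'a::field poly mat" where
  "L_completion k = mat (k + 1) (k + 1)
     (\<lambda>(i, j). if j = k then monom 1 (k - i) else if i \<le> j then - monom 1 (j - i) else 0)"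

text \<open>The same design for the reversed pencil, with rows \<open>-x, 1\<close>: the last column
  \<open>[1, x, ..., x^k]\<close> is annihilated and the other columns form a right inverse.\<close>

definition rev_L_completion :: "nat \<Rightarrow> 'a::field poly mat" where
  "rev_L_completion k = mat (k + 1) (k + 1)
     (\<lambda>(i, j). if j = k then monom 1 i else if j < i then monom 1 (i - j - 1) else 0)"

lemma L_pencil_dims [simp]: "dim_row (L_pencil k) = k" "dim_col (L_pencil k) = k + 1"
  by (simp_all add: L_pencil_def)

lemma rev_mat_L_pencil:
  "rev_mat 1 (L_pencil k) =
    mat k (k + 1) (\<lambda>(i, j). if j = i then [:0, -1:] else if j = i + 1 then 1 else 0)"
  by (rule eq_matI) (auto simp: rev_mat_def L_pencil_def monom_altdef)

lemma bidiagonal_row_sum: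
  fixes f :: "nat \<Rightarrow> 'a::comm_ring_1"
  assumes "i < k"
  shows "(\<Sum>s = 0..<k + 1. (if s = i then a else if s = i + 1 then b else 0) * f s) = a * f i + b * f (i + 1)"
proof -
  have "(\<Sum>s = 0..<k + 1. (if s = i then a else if s = i + 1 then b else 0) * f s) =
    (\<Sum>s \<in> {i, i + 1}. (if s = i then a else if s = i + 1 then b else 0) * f s)"
    using assms by (intro sum.mono_neutral_right) auto
  then show ?thesis by simp
qed

lemma L_pencil_times_completion:
  "L_pencil k * L_completion k = mat k (k + 1) (\<lambda>(i, j). if i = j then 1 else 0 :: 'a::field poly)"
proof (rule eq_matI, goal_cases)
  case (1 i j)
  then have ij: "i < k" "j < k + 1" by auto
  have "(L_pencil k * L_completion k) $$ (i, j) =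
    (\<Sum>s = 0..<k + 1. (if s = i then -1 else if s = i + 1 then [:0, 1:] else 0) * (L_completion k $$ (s, j) :: 'a poly))"
    using ij by (auto simp: scalar_prod_def L_pencil_def L_completion_def intro!: sum.cong)
  also have "\<dots> = - L_completion k $$ (i, j) + [:0, 1:] * L_completion k $$ (i + 1, j)"
    by (subst bidiagonal_row_sum[OF ij(1)]) simp
  also have "\<dots> = (if i = j then 1 else 0)"
    using ij by (auto simp: L_completion_def minus_monom monom_Suc[symmetric] Suc_diff_Suc)
  finally show ?case using ij by simp
qed (auto simp: L_pencil_def L_completion_def)

lemma rev_L_pencil_times_completion:
  "rev_mat 1 (L_pencil k) * rev_L_completion k =
    mat k (k + 1) (\<lambda>(i, j). if i = j then 1 else 0 :: 'a::field poly)"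
proof (rule eq_matI, goal_cases)
  case (1 i j)
  then have ij: "i < k" "j < k + 1" by auto
  have "(rev_mat 1 (L_pencil k) * rev_L_completion k) $$ (i, j) =
    (\<Sum>s = 0..<k + 1. (if s = i then [:0, -1:] else if s = i + 1 then 1 else 0) * (rev_L_completion k $$ (s, j) :: 'a poly))"
    using ij unfolding rev_mat_L_pencil by (auto simp: scalar_prod_def rev_L_completion_def intro!: sum.cong)
  also have "\<dots> = [:0, -1:] * rev_L_completion k $$ (i, j) + rev_L_completion k $$ (i + 1, j)"
    by (subst bidiagonal_row_sum[OF ij(1)]) simp
  also have "\<dots> = (if i = j then 1 else 0)"
    using ij by (auto simp: rev_L_completion_def minus_monom add_monom monom_Suc[symmetric] Suc_diff_Suc)
  finally show ?case using ij by simp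
qed (auto simp: rev_mat_def L_pencil_def rev_L_completion_def)

text \<open>Appending the unit row that selects entry \<open>e\<close> of each column turns \<open>K\<close> into an inverse
  of \<open>G\<close>.\<close>

lemma append_unit_row_inverse:
  fixes K G :: "'a::comm_ring_1 mat"
  assumes K: "K \<in> carrier_mat k (k + 1)" and G: "G \<in> carrier_mat (k + 1) (k + 1)"
    and KG: "K * G = mat k (k + 1) (\<lambda>(i, j). if i = j then 1 else 0)"
    and e: "e < k + 1" "\<And>j. j < k + 1 \<Longrightarrow> G $$ (e, j) = (if j = k then 1 else 0)"
  shows "\<exists>H \<in> carrier_mat (k + 1) (k + 1). H * G = 1\<^sub>m (k + 1)"
proof
  let ?H = "mat (k + 1) (k + 1) (\<lambda>(i, j). if i < k then K $$ (i, j) else if j = e then 1 else 0)"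
  show "?H \<in> carrier_mat (k + 1) (k + 1)" by simp
  show "?H * G = 1\<^sub>m (k + 1)"
  proof (rule eq_matI, goal_cases)
    case (1 i j)
    then have ij: "i < k + 1" "j < k + 1" by auto
    show ?case
    proof (cases "i < k")
      case True
      have "(?H * G) $$ (i, j) = (K * G) $$ (i, j)"
        using K G ij True by (auto simp: scalar_prod_def)
      then show ?thesis
        using ij True by (simp add: KG)
    next
      case False
      have "(?H * G) $$ (i, j) = (\<Sum>s = 0..<k + 1. ?H $$ (i, s) * G $$ (s, j))"
        using G ij by (simp add: scalar_prod_def del: sum.op_ivl_Suc)
      also have "\<dots> = (\<Sum>s = 0..<k + 1. if s = e then G $$ (s, j) else 0)"
        using ij False by (intro sum.cong) auto
      also have "\<dots> = 1\<^sub>m (k + 1) $$ (i, j)"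
        using False ij e by auto
      finally show ?thesis .
    qed
  qed (use G in auto)
qed

section \<open>Antidiagonal block sums\<close>

lemma antidiag_block_sum_carrier: "antidiag_block_sum \<epsilon> n \<eta> m M t \<in> carrier_mat m n"
  by (simp add: antidiag_block_sum_def mat_sum_def)

text \<open>Blocks are counted from 0 here and from 1 in the definition, hence
  \<open>a + b + 2\<close>. The constraint moves into an \<open>if\<close>, so that sums for
  different \<open>t\<close> range over the same rectangle and can be added termwise.\<close>

lemma antidiag_block_sum_index:
  assumes "r < m" "c < n"
  shows "antidiag_block_sum \<epsilon> n \<eta> m M t $$ (r, c) =
    (\<Sum>a = 0..<\<eta> + 1. \<Sum>b = 0..<\<epsilon> + 1. if a + b + 2 = t then M $$ (a * m + r, b * n + c) else 0)"
proof -
  let ?S = "{(i, j). 1 \<le> i \<and> i \<le> \<eta> + 1 \<and> 1 \<le> j \<and> j \<le> \<epsilon> + 1 \<and> i + j = t}"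
  let ?T = "{x \<in> {0..<\<eta> + 1} \<times> {0..<\<epsilon> + 1}. fst x + snd x + 2 = t}"
  have "antidiag_block_sum \<epsilon> n \<eta> m M t $$ (r, c) =
      (\<Sum>(i, j) \<in> ?S. M $$ ((i - 1) * m + r, (j - 1) * n + c))"
    using assms
    by (auto simp: antidiag_block_sum_def mat_sum_def mat_block_def case_prod_unfold intro!: sum.cong)
  also have "\<dots> = (\<Sum>(a, b) \<in> ?T. M $$ (a * m + r, b * n + c))"
    by (rule sum.reindex_bij_witness[of _ "\<lambda>(a, b). (a + 1, b + 1)" "\<lambda>(i, j). (i - 1, j - 1)"]) auto
  also have "\<dots> = (\<Sum>x \<in> {0..<\<eta> + 1} \<times> {0..<\<epsilon> + 1}.
      if fst x + snd x + 2 = t then case x of (a, b) \<Rightarrow> M $$ (a * m + r, b * n + c) else 0)"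
    by (rule sum.inter_filter) simp
  also have "\<dots> = (\<Sum>a = 0..<\<eta> + 1. \<Sum>b = 0..<\<epsilon> + 1.
      if a + b + 2 = t then M $$ (a * m + r, b * n + c) else 0)"
    by (simp only: sum.cartesian_product case_prod_unfold)
  finally show ?thesis .
qed

lemma block_index_less:
  fixes a r m K :: nat
  assumes "a \<le> K" "r < m"
  shows "a * m + r < (K + 1) * m"
proof -
  have "a * m + r < a * m + m" using assms by simp
  also have "\<dots> \<le> (K + 1) * m" using assms by simp
  finally show ?thesis .
qed

section \<open>Grade and reversal of the pencil\<close>

lemma has_grade_four_block:
  assumes "A \<in> carrier_mat a b" "B \<in> carrier_mat a b'" "C \<in> carrier_mat a' b" "D \<in> carrier_mat a' b'"
    and "has_grade k A" "has_grade k B" "has_grade k C" "has_grade k D"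
  shows "has_grade k (four_block_mat A B C D)"
  using assms by (auto simp: has_grade_def)

lemma has_grade_transpose: "has_grade k A \<Longrightarrow> has_grade k (A\<^sup>T)"
  by (auto simp: has_grade_def)

lemma has_grade_kron_one:
  assumes "has_grade k A"
  shows "has_grade k (A \<otimes>\<^sub>k 1\<^sub>m n)"
  using assms by (auto simp: has_grade_def kron_one_index less_mult_imp_div_less)

lemma has_grade_rev_mat: "has_grade d (rev_mat d P)"
  unfolding has_grade_def rev_mat_def
  by (auto intro!: degree_sum_le order.trans[OF degree_monom_le])

lemma has_grade_block_kronecker_pencil:
  assumes "M0 \<in> carrier_mat ((\<eta> + 1) * m) ((\<epsilon> + 1) * n)"
    and "M1 \<in> carrier_mat ((\<eta> + 1) * m) ((\<epsilon> + 1) * n)"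
  shows "has_grade 1 (block_kronecker_pencil \<epsilon> n \<eta> m M1 M0)"
  unfolding block_kronecker_pencil_def
proof (rule has_grade_four_block)
  have L: "has_grade 1 (L_pencil k)" for k
    by (auto simp: has_grade_def L_pencil_def)
  then show "has_grade 1 ((L_pencil \<eta>)\<^sup>T \<otimes>\<^sub>k 1\<^sub>m m)" "has_grade 1 (L_pencil \<epsilon> \<otimes>\<^sub>k 1\<^sub>m n)"
    by (auto intro!: has_grade_kron_one has_grade_transpose)
  show "has_grade 1 (pencil M1 M0)"
    using assms by (auto simp: has_grade_def pencil_def)
  show "has_grade 1 (0\<^sub>m (\<epsilon> * n) (\<eta> * m))"
    by (auto simp: has_grade_def)
qed (use assms in \<open>auto simp: pencil_def L_pencil_def intro!: carrier_matI\<close>)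

text \<open>Reversal acts entrywise, so it passes through the block structure and through
  \<open>\<otimes> I\<close>, whose entries are 0 or entries of the first factor. In grade 1 it
  exchanges the coefficients of the leading pencil.\<close>

lemma rev_mat_block_kronecker_pencil:
  assumes M0: "M0 \<in> carrier_mat ((\<eta> + 1) * m) ((\<epsilon> + 1) * n)"
    and M1: "M1 \<in> carrier_mat ((\<eta> + 1) * m) ((\<epsilon> + 1) * n)"
  shows "rev_mat 1 (block_kronecker_pencil \<epsilon> n \<eta> m M1 M0) = four_block_mat
     (pencil M0 M1) ((rev_mat 1 (L_pencil \<eta>))\<^sup>T \<otimes>\<^sub>k 1\<^sub>m m)
     (rev_mat 1 (L_pencil \<epsilon>) \<otimes>\<^sub>k 1\<^sub>m n) (0\<^sub>m (\<epsilon> * n) (\<eta> * m))"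
proof -
  have kron: "rev_mat 1 (A \<otimes>\<^sub>k 1\<^sub>m l) = rev_mat 1 A \<otimes>\<^sub>k 1\<^sub>m l" for A :: "'a poly mat" and l
    by (rule eq_matI) (auto simp: rev_mat_def kron_one_index less_mult_imp_div_less)
  have tr: "rev_mat 1 (A\<^sup>T) = (rev_mat 1 A)\<^sup>T" for A :: "'a poly mat"
    by (rule eq_matI) (auto simp: rev_mat_def)
  have p: "rev_mat 1 (pencil M1 M0) = pencil M0 M1"
    using M0 M1 by (intro eq_matI) (auto simp: rev_mat_def pencil_def monom_altdef)
  have z: "rev_mat 1 (0\<^sub>m k l) = 0\<^sub>m k l" for k l
    by (rule eq_matI) (auto simp: rev_mat_def)
  have "rev_mat 1 (block_kronecker_pencil \<epsilon> n \<eta> m M1 M0) = four_block_mat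
    (rev_mat 1 (pencil M1 M0)) (rev_mat 1 ((L_pencil \<eta>)\<^sup>T \<otimes>\<^sub>k 1\<^sub>m m))
    (rev_mat 1 (L_pencil \<epsilon> \<otimes>\<^sub>k 1\<^sub>m n)) (rev_mat 1 (0\<^sub>m (\<epsilon> * n) (\<eta> * m)))"
    unfolding block_kronecker_pencil_def rev_mat_def
    by (rule map_four_block_mat[of _ "(\<eta> + 1) * m" "(\<epsilon> + 1) * n" _ "\<eta> * m" _ "\<epsilon> * n"])
      (use M0 M1 in \<open>auto simp: pencil_def L_pencil_def intro!: carrier_matI\<close>)
  then show ?thesis
    by (simp only: kron tr p z)
qed

section \<open>Kronecker factors acting on vectors read block by block\<close>

lemma sum_blocks:
  fixes K n :: nat
  shows "(\<Sum>j = 0..<K * n. g j) = (\<Sum>b = 0..<K. \<Sum>c = 0..<n. g (b * n + c))"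
proof -
  have "(\<Sum>j = 0..<K * n. g j) = (\<Sum>j = 0..<K * n. \<Sum>c = 0..<n. if j mod n = c then g j else 0)"
    by (intro sum.cong refl) (cases "n = 0"; simp)
  also have "\<dots> = (\<Sum>c = 0..<n. \<Sum>j = 0..<K * n. if j mod n = c then g j else 0)"
    by (rule sum.swap)
  also have "\<dots> = (\<Sum>c = 0..<n. \<Sum>b = 0..<K. g (b * n + c))"
    by (intro sum.cong refl block_sum) auto
  also have "\<dots> = (\<Sum>b = 0..<K. \<Sum>c = 0..<n. g (b * n + c))"
    by (rule sum.swap)
  finally show ?thesis .
qed

lemma all_block_index_iff:
  fixes K n :: nat
  shows "(\<forall>k<K * n. R k) \<longleftrightarrow> (\<forall>a<K. \<forall>c<n. R (a * n + c))"
proof (intro iffI allI impI)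
  fix a c assume "\<forall>k<K * n. R k" "a < K" "c < n"
  moreover have "a * n + c < K * n"
    using block_index_less[of a "K - 1" c n] \<open>a < K\<close> \<open>c < n\<close> by simp
  ultimately show "R (a * n + c)" by blast
next
  fix k assume R: "\<forall>a<K. \<forall>c<n. R (a * n + c)" and k: "k < K * n"
  then have "0 < n" by (cases n) auto
  then have "k div n < K" "k mod n < n"
    using k by (simp_all add: less_mult_imp_div_less)
  then have "R (k div n * n + k mod n)"
    using R by blast
  then show "R k" by simp
qed

lemma kron_one_mult_vec_index:
  fixes A :: "'a::comm_ring_1 mat"
  assumes A: "A \<in> carrier_mat k l" and y: "dim_vec y = l * n" and a: "a < k" "c < n"
  shows "((A \<otimes>\<^sub>k 1\<^sub>m n) *\<^sub>v y) $ (a * n + c) = (\<Sum>b = 0..<l. A $$ (a, b) * y $ (b * n + c))"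
proof -
  have i: "a * n + c < k * n"
    using block_index_less[of a "k - 1" c n] a by simp
  have "((A \<otimes>\<^sub>k 1\<^sub>m n) *\<^sub>v y) $ (a * n + c) = (\<Sum>j = 0..<l * n. (A \<otimes>\<^sub>k 1\<^sub>m n) $$ (a * n + c, j) * y $ j)"
    using A y i by (simp add: scalar_prod_def)
  also have "\<dots> = (\<Sum>j = 0..<l * n. if j mod n = c then A $$ (a, j div n) * y $ j else 0)"
    using A i a by (intro sum.cong refl) (auto simp: kron_one_index)
  also have "\<dots> = (\<Sum>b = 0..<l. A $$ (a, b) * y $ (b * n + c))"
    using a by (subst block_sum) auto
  finally show ?thesis .
qed

lemma L_pencil_mult_vec_index:
  fixes y :: "'a::field poly vec"
  assumes "dim_vec y = (k + 1) * n" "a < k" "c < n"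
  shows "((L_pencil k \<otimes>\<^sub>k 1\<^sub>m n) *\<^sub>v y) $ (a * n + c) =
    - y $ (a * n + c) + [:0, 1:] * y $ ((a + 1) * n + c)"
proof -
  have "((L_pencil k \<otimes>\<^sub>k 1\<^sub>m n) *\<^sub>v y) $ (a * n + c) =
    (\<Sum>b = 0..<k + 1. L_pencil k $$ (a, b) * y $ (b * n + c))"
    by (rule kron_one_mult_vec_index) (use assms in \<open>auto simp: L_pencil_def\<close>)
  also have "\<dots> = (\<Sum>b = 0..<k + 1. (if b = a then -1 else if b = a + 1 then [:0, 1:] else 0) * y $ (b * n + c))"
    using assms by (intro sum.cong refl) (auto simp: L_pencil_def)
  also have "\<dots> = - y $ (a * n + c) + [:0, 1:] * y $ ((a + 1) * n + c)"
    using assms(2) by (subst bidiagonal_row_sum) auto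
  finally show ?thesis .
qed

lemma transpose_L_pencil_mult_vec_index:
  fixes z :: "'a::field poly vec"
  assumes z: "dim_vec z = k * n" and a: "a \<le> k" "c < n"
  shows "(((L_pencil k)\<^sup>T \<otimes>\<^sub>k 1\<^sub>m n) *\<^sub>v z) $ (a * n + c) =
    (if a < k then - z $ (a * n + c) else 0) +
    (if 0 < a then [:0, 1:] * z $ ((a - 1) * n + c) else 0)"
proof -
  have "(((L_pencil k)\<^sup>T \<otimes>\<^sub>k 1\<^sub>m n) *\<^sub>v z) $ (a * n + c) =
    (\<Sum>b = 0..<k. (L_pencil k)\<^sup>T $$ (a, b) * z $ (b * n + c))"
    by (rule kron_one_mult_vec_index[where k = "k + 1"]) (use assms in \<open>auto simp: L_pencil_def\<close>)
  \<comment> \<open>For \<open>a = 0\<close> the truncated \<open>a - 1\<close> is 0, so the second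
    term carries the guard \<open>0 < a\<close>. For \<open>a = k\<close> the first condition never
    holds in the range of \<open>b\<close>.\<close>
  also have "\<dots> = (\<Sum>b = 0..<k. (if b = a then - z $ (b * n + c) else 0) +
      (if b = a - 1 then (if 0 < a then [:0, 1:] * z $ (b * n + c) else 0) else 0))"
    using a by (intro sum.cong refl) (auto simp: L_pencil_def)
  also have "\<dots> = (if a < k then - z $ (a * n + c) else 0) +
    (if 0 < a then [:0, 1:] * z $ ((a - 1) * n + c) else 0)"
    using a by (auto simp: sum.distrib)
  finally show ?thesis .
qed

subsection \<open>Minimal bases of null spaces\<close>

lemma degree_le_vec_degree: "i < dim_vec v \<Longrightarrow> degree (v $ i) \<le> vec_degree v"
  unfolding vec_degree_def by (rule Max_ge) auto

text \<open>The dimension is positive because \<open>Max\<close> of the empty set is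
  unspecified.\<close>

lemma vec_degree_leI:
  assumes "0 < dim_vec v" "\<And>i. i < dim_vec v \<Longrightarrow> degree (v $ i) \<le> D"
  shows "vec_degree v \<le> D"
  unfolding vec_degree_def using assms by (intro Max.boundedI) auto

text \<open>If the maximum is attained at a zero entry, it is 0, and then any nonzero entry attains
  it too.\<close>

lemma vec_degree_attained:
  assumes "v \<noteq> 0\<^sub>v (dim_vec v)"
  shows "\<exists>i<dim_vec v. v $ i \<noteq> 0 \<and> degree (v $ i) = vec_degree v"
proof -
  obtain j where j: "j < dim_vec v" "v $ j \<noteq> 0"
    using assms by (metis eq_vecI index_zero_vec)
  have "vec_degree v \<in> (\<lambda>i. degree (v $ i)) ` {..<dim_vec v}"
    unfolding vec_degree_def using j by (intro Max_in) auto
  then obtain i where i: "i < dim_vec v" "degree (v $ i) = vec_degree v" by auto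
  show ?thesis
  proof (cases "v $ i = 0")
    case True
    then have "degree (v $ j) = vec_degree v"
      using i degree_le_vec_degree[OF j(1)] by simp
    then show ?thesis using j by blast
  qed (use i in blast)
qed

text \<open>Steinitz exchange with control over the vector given up: as \<open>w\<close> is outside
  the span of \<open>B'\<close>, its expansion in \<open>B\<close> has a nonzero coefficient at some
  \<open>b\<close> outside \<open>B'\<close>.\<close>

lemma (in vectorspace) basis_exchange:
  assumes fin: "finite B" and B: "basis B" and sub: "B' \<subseteq> B"
    and w: "w \<in> carrier V" "w \<notin> B" "w \<notin> span B'"
  shows "\<exists>b \<in> B - B'. basis (insert w (B - {b}))"
proof -
  have Bc: "B \<subseteq> carrier V" and gen: "span B = carrier V"
    using B by (auto simp: basis_def)
  obtain a where a: "a \<in> B \<rightarrow> carrier K" "lincomb a B = w"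
    using finite_in_span[OF fin Bc] w gen by blast
  have "\<exists>b \<in> B - B'. a b \<noteq> \<zero>\<^bsub>K\<^esub>"
  proof (rule ccontr)
    assume "\<not> ?thesis"
    then have z: "a b = \<zero>\<^bsub>K\<^esub>" if "b \<in> B - B'" for b using that by blast
    have fin': "finite B'" "finite (B - B')" using fin sub finite_subset by auto
    have "lincomb a B = lincomb a (B' \<union> (B - B'))"
      using sub by (simp add: Un_absorb1)
    also have "\<dots> = lincomb a B' \<oplus>\<^bsub>V\<^esub> lincomb a (B - B')"
      by (rule module.lincomb_union) (use fin sub Bc a in \<open>auto simp: Un_absorb1\<close>)
    also have "lincomb a (B - B') = \<zero>\<^bsub>V\<^esub>"
      by (rule lincomb_zero) (use Bc z in auto)
    also have "lincomb a B' \<oplus>\<^bsub>V\<^esub> \<zero>\<^bsub>V\<^esub> = lincomb a B'"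
      using sub Bc a by (intro r_zero lincomb_closed) auto
    also have "\<dots> \<in> span B'"
      using fin' a sub by (auto simp: span_def)
    finally show False using a w by simp
  qed
  then obtain b where b: "b \<in> B" "b \<notin> B'" "a b \<noteq> \<zero>\<^bsub>K\<^esub>" by auto
  \<comment> \<open>The coefficient -1 at \<open>w\<close> turns the expansion of \<open>w\<close>
    into a vanishing combination, from which \<open>b\<close> can be isolated.\<close>
  define a' where "a' = (\<lambda>v. if v = w then \<ominus>\<^bsub>K\<^esub> \<one>\<^bsub>K\<^esub> else a v)"
  have a': "a' \<in> insert w B \<rightarrow> carrier K" using a by (auto simp: a'_def)
  have "lincomb a' (insert w B) = a' w \<odot>\<^bsub>V\<^esub> w \<oplus>\<^bsub>V\<^esub> lincomb a' B"
    by (rule lincomb_insert2[OF fin Bc a' w(2,1)])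
  also have "lincomb a' B = lincomb a B"
    by (rule lincomb_cong) (use w Bc a in \<open>auto simp: a'_def\<close>)
  also have "a' w \<odot>\<^bsub>V\<^esub> w \<oplus>\<^bsub>V\<^esub> lincomb a B = \<zero>\<^bsub>V\<^esub>"
    using w a by (simp add: a'_def smult_minus_1 M.l_neg)
  finally have lc: "lincomb a' (insert w B) = \<zero>\<^bsub>V\<^esub>" .
  have "b \<in> span (insert w B - {b})"
    by (rule lincomb_isolate(2)[OF _ _ a' _ _ lc]) (use fin Bc w b in \<open>auto simp: a'_def\<close>)
  then have bspan: "b \<in> span (insert w (B - {b}))"
    using b w by (auto simp: insert_Diff_if split: if_splits)
  have "basis (insert w (B - {b}))"
    by (rule basis_swap[where u = b]) (use fin b Bc w B bspan in \<open>auto simp: insert_absorb\<close>)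
  then show ?thesis using b by auto
qed

abbreviation fract_vec :: "'a::field poly vec \<Rightarrow> 'a poly fract vec" where
  "fract_vec \<equiv> map_vec to_fract"

abbreviation fract_mat :: "'a::field poly mat \<Rightarrow> 'a poly fract mat" where
  "fract_mat \<equiv> map_mat to_fract"

lemma inj_fract_vec: "inj fract_vec"
  by (rule injI) (rule to_fract_hom.vec_hom_inj)

lemma fract_vec_mem_kernel_iff:
  "fract_vec v \<in> mat_kernel (fract_mat P) \<longleftrightarrow> v \<in> mat_kernel P"
proof (cases "v \<in> carrier_vec (dim_col P)")
  case True
  have "fract_mat P *\<^sub>v fract_vec v = fract_vec (P *\<^sub>v v)"
    by (rule to_fract_hom.mult_mat_vec_hom[symmetric, of P "dim_row P" "dim_col P"]) (use True in auto)
  then show ?thesis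
    using True by (simp add: mat_kernel_def)
next
  case False
  then show ?thesis by (simp add: mat_kernel_def)
qed

lemma common_denominator:
  fixes S :: "'a::field poly fract set"
  assumes "finite S"
  shows "\<exists>p. p \<noteq> 0 \<and> (\<forall>x\<in>S. \<exists>q. to_fract p * x = to_fract q)"
  using assms
proof (induction S)
  case empty
  show ?case by (rule exI[of _ 1]) auto
next
  case (insert x S)
  then obtain p where p: "p \<noteq> 0" "\<forall>x\<in>S. \<exists>q. to_fract p * x = to_fract q" by auto
  obtain a b where ab: "b \<noteq> 0" "x = Fract a b" by (cases x) auto
  have x: "to_fract b * x = to_fract a"
    using ab by (simp add: to_fract_def eq_fract)
  show ?case
  proof (rule exI[of _ "b * p"], intro conjI ballI)
    show "b * p \<noteq> 0" using p ab by simp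
    fix y assume "y \<in> insert x S"
    then consider "y = x" | "y \<in> S" by auto
    then show "\<exists>q. to_fract (b * p) * y = to_fract q"
    proof cases
      case 1
      have "to_fract (b * p) * y = to_fract p * (to_fract b * x)"
        using 1 by (simp add: to_fract_hom.hom_mult mult_ac)
      also have "\<dots> = to_fract (p * a)"
        unfolding x by (simp add: to_fract_hom.hom_mult)
      finally show ?thesis by blast
    next
      case 2
      then obtain q where q: "to_fract p * y = to_fract q" using p by blast
      have "to_fract (b * p) * y = to_fract b * (to_fract p * y)"
        by (simp add: to_fract_hom.hom_mult mult_ac)
      also have "\<dots> = to_fract (b * q)"
        unfolding q by (simp add: to_fract_hom.hom_mult)
      finally show ?thesis by blast
    qed
  qed
qed

lemma clear_denominators:
  fixes v :: "'a::field poly fract vec"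
  shows "\<exists>p u. p \<noteq> 0 \<and> dim_vec u = dim_vec v \<and> fract_vec u = to_fract p \<cdot>\<^sub>v v"
proof -
  obtain p where p: "p \<noteq> 0" "\<forall>x\<in>vec_set v. \<exists>q. to_fract p * x = to_fract q"
    using common_denominator[of "vec_set v"] by (auto simp: vec_set_def)
  have "\<forall>i<dim_vec v. \<exists>q. to_fract p * v $ i = to_fract q"
    using p by (auto simp: vec_set_def)
  then obtain q where q: "\<And>i. i < dim_vec v \<Longrightarrow> to_fract p * v $ i = to_fract (q i)"
    by metis
  have "fract_vec (vec (dim_vec v) q) = to_fract p \<cdot>\<^sub>v v"
    by (rule eq_vecI) (auto simp: q)
  then show ?thesis
    using p by (intro exI[of _ p] exI[of _ "vec (dim_vec v) q"]) auto
qed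

text \<open>Both sides speak of the same vector space by definition, which makes the theory of
  matrix kernels available for polynomial bases.\<close>

lemma polynomial_basis_kernel_iff:
  assumes "A \<in> carrier_mat k n"
  shows "polynomial_basis n (mat_kernel A) B \<longleftrightarrow> finite B \<and> kernel.basis n A (fract_vec ` B)"
  unfolding polynomial_basis_def by (rule refl)

text \<open>Each vector of an arbitrary basis is multiplied by a common denominator of its entries.
  The results still generate the null space.\<close>

lemma exists_polynomial_basis:
  fixes A :: "'a::field poly fract mat"
  assumes A: "A \<in> carrier_mat k n"
  shows "\<exists>B. polynomial_basis n (mat_kernel A) B"
proof -
  interpret kernel k n A by unfold_locales (rule A)
  obtain S where S: "finite S" "basis S"
    using kernel_basis_exists[OF A] by auto
  then have Sk: "S \<subseteq> mat_kernel A" and gen: "span S = mat_kernel A"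
    by (auto simp: Ker.basis_def)
  have "\<forall>v :: 'a poly fract vec. \<exists>p u. p \<noteq> 0 \<and> fract_vec u = to_fract p \<cdot>\<^sub>v v"
    using clear_denominators by blast
  then obtain p u where
    pu: "\<And>v :: 'a poly fract vec. p v \<noteq> 0" "\<And>v :: 'a poly fract vec. fract_vec (u v) = to_fract (p v) \<cdot>\<^sub>v v"
    by metis
  let ?T = "fract_vec ` u ` S"
  have T: "?T \<subseteq> mat_kernel A"
    using Sk mat_kernel_smult[OF A] by (auto simp: pu)
  have "S \<subseteq> span ?T"
  proof
    fix v assume v: "v \<in> S"
    have "v = inverse (to_fract (p v)) \<cdot>\<^sub>v fract_vec (u v)"
      using pu by (simp add: smult_smult_assoc)
    moreover have "fract_vec (u v) \<in> span ?T"
      using Ker.in_own_span[OF T] v by auto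
    ultimately show "v \<in> span ?T"
      using submodule.smult_closed[OF Ker.span_is_submodule[OF T],
          of "inverse (to_fract (p v))" "fract_vec (u v)"]
      by (simp add: class_ring_simps)
  qed
  then have "span S \<subseteq> span ?T"
    by (rule Ker.span_is_subset[OF _ Ker.span_is_submodule[OF T]])
  then have gen': "span ?T = mat_kernel A"
    using gen Ker.span_is_subset2[OF T] by auto
  \<comment> \<open>A generating set of at most \<open>dim\<close> vectors is a basis, so neither
    distinctness nor independence of the scaled vectors has to be checked.\<close>
  have "card ?T \<le> card S"
    using card_image_le[OF S(1), of "\<lambda>v. fract_vec (u v)"] by (simp add: image_image)
  then have "card ?T \<le> dim"
    using Ker.dim_basis[OF S] by simp
  then have "basis ?T"
    using S T gen' by (intro Ker.dim_gen_is_basis) auto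
  then show ?thesis
    using S polynomial_basis_kernel_iff[OF A] by blast
qed

lemma exists_minimal_basis:
  fixes A :: "'a::field poly fract mat"
  assumes A: "A \<in> carrier_mat k n"
  shows "\<exists>B. minimal_basis n (mat_kernel A) B"
proof -
  obtain B0 where "polynomial_basis n (mat_kernel A) B0"
    using exists_polynomial_basis[OF A] ..
  then show ?thesis
    using ex_has_least_nat[of "polynomial_basis n (mat_kernel A)" B0 "sum vec_degree"]
    unfolding minimal_basis_def by auto
qed

text \<open>Otherwise \<open>w\<close> could replace a basis vector of larger degree.\<close>

lemma minimal_basis_low_degree_span:
  fixes A :: "'a::field poly fract mat"
  assumes A: "A \<in> carrier_mat k n"
    and B: "minimal_basis n (mat_kernel A) B" and w: "fract_vec w \<in> mat_kernel A"
  shows "fract_vec w \<in> kernel.span n A (fract_vec ` {b \<in> B. vec_degree b \<le> vec_degree w})"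
proof (rule ccontr)
  interpret kernel k n A by unfold_locales (rule A)
  let ?B' = "fract_vec ` {b \<in> B. vec_degree b \<le> vec_degree w}"
  assume nspan: "fract_vec w \<notin> span ?B'"
  have fin: "finite B" and basis: "basis (fract_vec ` B)"
    using B by (auto simp: minimal_basis_def polynomial_basis_kernel_iff[OF A])
  then have Bk: "fract_vec ` B \<subseteq> mat_kernel A"
    by (auto simp: Ker.basis_def)
  have B'k: "?B' \<subseteq> mat_kernel A" using Bk by auto
  have "w \<notin> B"
    using nspan Ker.in_own_span[OF B'k] by auto
  then have "fract_vec w \<notin> fract_vec ` B"
    using inj_fract_vec by (auto dest: injD)
  then obtain b where b: "b \<in> B" "fract_vec b \<notin> ?B'"
    "basis (insert (fract_vec w) (fract_vec ` B - {fract_vec b}))"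
    using Ker.basis_exchange[of "fract_vec ` B" ?B' "fract_vec w"] fin basis w nspan by auto
  have "insert (fract_vec w) (fract_vec ` B - {fract_vec b}) = fract_vec ` insert w (B - {b})"
    using inj_fract_vec by (auto dest: injD)
  then have "polynomial_basis n (mat_kernel A) (insert w (B - {b}))"
    using b fin by (simp add: polynomial_basis_kernel_iff[OF A])
  then have "sum vec_degree B \<le> sum vec_degree (insert w (B - {b}))"
    using B by (auto simp: minimal_basis_def)
  also have "\<dots> = vec_degree w + sum vec_degree (B - {b})"
    using fin \<open>w \<notin> B\<close> by simp
  \<comment> \<open>\<open>b\<close> lies outside \<open>?B'\<close>, so its degree exceeds that of
    \<open>w\<close>.\<close>
  also have "\<dots> < vec_degree b + sum vec_degree (B - {b})"
    using b by auto
  also have "\<dots> = sum vec_degree B"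
    using fin b by (simp add: sum.remove)
  finally show False by simp
qed

text \<open>By \<open>minimal_basis_low_degree_span\<close>, the vectors of \<open>C\<close> of
  degree at most \<open>t\<close> lie in the span of those of \<open>B\<close>, and they are
  independent. Exchanging \<open>B\<close> and \<open>C\<close> gives equality of the
  counts.\<close>

lemma minimal_basis_card_le:
  fixes A :: "'a::field poly fract mat"
  assumes A: "A \<in> carrier_mat k n"
    and B: "minimal_basis n (mat_kernel A) B" and C: "minimal_basis n (mat_kernel A) C"
  shows "card {c \<in> C. vec_degree c \<le> t} \<le> card {b \<in> B. vec_degree b \<le> t}"
proof -
  interpret kernel k n A by unfold_locales (rule A)
  have fin: "finite B" "finite C" and basis: "basis (fract_vec ` B)" "basis (fract_vec ` C)"
    using B C by (auto simp: minimal_basis_def polynomial_basis_kernel_iff[OF A])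
  then have k: "fract_vec ` B \<subseteq> mat_kernel A" "fract_vec ` C \<subseteq> mat_kernel A"
    and li: "lin_indpt (fract_vec ` C)"
    by (auto simp: Ker.basis_def)
  let ?B = "{b \<in> B. vec_degree b \<le> t}" and ?C = "{c \<in> C. vec_degree c \<le> t}"
  have inj: "inj_on fract_vec X" for X :: "'a poly vec set"
    by (rule inj_on_subset[OF inj_fract_vec]) simp
  have "fract_vec ` ?C \<subseteq> span (fract_vec ` ?B)"
  proof
    fix x assume "x \<in> fract_vec ` ?C"
    then obtain c where c: "x = fract_vec c" "c \<in> C" "vec_degree c \<le> t" by auto
    then have "x \<in> span (fract_vec ` {b \<in> B. vec_degree b \<le> vec_degree c})"
      using minimal_basis_low_degree_span[OF A B, of c] k by auto
    also have "\<dots> \<subseteq> span (fract_vec ` ?B)"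
      by (rule Ker.span_is_monotone) (use c in auto)
    finally show "x \<in> span (fract_vec ` ?B)" .
  qed
  moreover have "fract_vec ` ?B \<subseteq> mat_kernel A" "lin_indpt (fract_vec ` ?C)"
    using k Ker.subset_li_is_li[OF li, of "fract_vec ` ?C"] by auto
  \<comment> \<open>The replacement lemma supplies a set whose size is at most the difference of the
    two cardinalities, so this difference is nonnegative; nothing else about \<open>D\<close>
    matters.\<close>
  ultimately obtain D :: "'a poly fract vec set" where
    "int (card D) \<le> int (card (fract_vec ` ?B)) - int (card (fract_vec ` ?C))"
    using Ker.replacement[of "fract_vec ` ?C" "fract_vec ` ?B"] fin by auto
  then have "card (fract_vec ` ?C) \<le> card (fract_vec ` ?B)" by linarith
  then show ?thesis
    by (simp add: card_image[OF inj])
qed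

text \<open>The multiplicity of \<open>t\<close> is the increment of the counting function from
  \<open>t - 1\<close> to \<open>t\<close>. At \<open>t = 0\<close> the truncated
  \<open>t - 1\<close> is again 0, hence the separate case in \<open>count\<close>.\<close>

lemma image_mset_eq_if_card_le_eq:
  fixes f :: "'a \<Rightarrow> nat" and g :: "'b \<Rightarrow> nat"
  assumes fin: "finite B" "finite C"
    and eq: "\<And>t. card {b \<in> B. f b \<le> t} = card {c \<in> C. g c \<le> t}"
  shows "image_mset f (mset_set B) = image_mset g (mset_set C)"
proof (rule multiset_eqI)
  fix t
  have count: "count (image_mset h (mset_set X)) t + (if t = 0 then 0 else card {x \<in> X. h x \<le> t - 1})
      = card {x \<in> X. h x \<le> t}" if "finite X" for X and h :: "'c \<Rightarrow> nat"
  proof -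
    have "count (image_mset h (mset_set X)) t = card {x \<in> X. h x = t}"
      using that by (simp add: count_image_mset sum.If_cases vimage_def Int_def conj_commute)
    moreover have "{x \<in> X. h x \<le> t} = {x \<in> X. h x = t} \<union> (if t = 0 then {} else {x \<in> X. h x \<le> t - 1})"
      by auto
    moreover have "card ({x \<in> X. h x = t} \<union> (if t = 0 then {} else {x \<in> X. h x \<le> t - 1})) =
      card {x \<in> X. h x = t} + card (if t = 0 then {} else {x \<in> X. h x \<le> t - 1})"
      by (rule card_Un_disjoint) (use that in auto)
    ultimately show ?thesis by simp
  qed
  show "count (image_mset f (mset_set B)) t = count (image_mset g (mset_set C)) t"
    using count[OF fin(1), of f] count[OF fin(2), of g] eq[of t] eq[of "t - 1"] by (simp split: if_splits)
qed

text \<open>The definite description is resolved by any one minimal basis, because all of them have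
  the same degree counts.\<close>

lemma minimal_indices_eqI:
  fixes A :: "'a::field poly fract mat"
  assumes A: "A \<in> carrier_mat k n" and B: "minimal_basis n (mat_kernel A) B"
  shows "minimal_indices n (mat_kernel A) =
    sorted_list_of_multiset (image_mset vec_degree (mset_set B))"
  unfolding minimal_indices_def
proof (rule the_equality)
  fix ds
  assume "\<exists>C. minimal_basis n (mat_kernel A) C \<and>
    ds = sorted_list_of_multiset (image_mset vec_degree (mset_set C))"
  then obtain C where C: "minimal_basis n (mat_kernel A) C"
    "ds = sorted_list_of_multiset (image_mset vec_degree (mset_set C))" by auto
  have "finite B" "finite C"
    using B C by (auto simp: minimal_basis_def polynomial_basis_def)
  then have "image_mset vec_degree (mset_set C) = image_mset vec_degree (mset_set B)"
    by (intro image_mset_eq_if_card_le_eq order.antisym minimal_basis_card_le[OF A] B C)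
  then show "ds = sorted_list_of_multiset (image_mset vec_degree (mset_set B))"
    using C by simp
qed (use B in blast)

section \<open>Transport of bases along a selection of coordinates\<close>

lemma kernel_bij_image_basis:
  fixes A :: "'a::field mat" and B :: "'a mat"
  assumes A: "A \<in> carrier_mat k n" and B: "B \<in> carrier_mat l h"
    and bij: "bij_betw T (mat_kernel A) (mat_kernel B)"
    and add: "\<And>v w. v \<in> mat_kernel A \<Longrightarrow> w \<in> mat_kernel A \<Longrightarrow> T (v + w) = T v + T w"
    and smult: "\<And>c v. v \<in> mat_kernel A \<Longrightarrow> T (c \<cdot>\<^sub>v v) = c \<cdot>\<^sub>v T v"
    and S: "kernel.basis n A S"
  shows "kernel.basis h B (T ` S)"
proof -
  interpret A: kernel k n A by unfold_locales (rule A)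
  interpret B: kernel l h B by unfold_locales (rule B)
  interpret linear_map class_ring A.VK B.VK T
  proof unfold_locales
    show "T \<in> LinearCombinations.module_hom class_ring A.VK B.VK"
      using add smult bij_betw_imp_surj_on[OF bij] by (auto simp: LinearCombinations.module_hom_def class_ring_simps)
  qed
  show ?thesis
  proof (rule linear_inj_image_is_basis)
    obtain R where R: "finite R" "A.basis R"
      using kernel_basis_exists[OF A] by auto
    then show "A.Ker.fin_dim"
      unfolding A.Ker.fin_dim_def by (auto simp: A.Ker.basis_def)
  qed (use bij S in \<open>auto simp: bij_betw_def\<close>)
qed

lemma kernel_bij_inv_image_basis:
  fixes A :: "'a::field mat" and B :: "'a mat"
  assumes A: "A \<in> carrier_mat k n" and B: "B \<in> carrier_mat l h"
    and bij: "bij_betw T (mat_kernel A) (mat_kernel B)"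
    and add: "\<And>v w. v \<in> mat_kernel A \<Longrightarrow> w \<in> mat_kernel A \<Longrightarrow> T (v + w) = T v + T w"
    and smult: "\<And>c v. v \<in> mat_kernel A \<Longrightarrow> T (c \<cdot>\<^sub>v v) = c \<cdot>\<^sub>v T v"
    and S: "kernel.basis h B S"
  shows "kernel.basis n A (inv_into (mat_kernel A) T ` S)"
proof (rule kernel_bij_image_basis[OF B A bij_betw_inv_into[OF bij] _ _ S])
  let ?g = "inv_into (mat_kernel A) T"
  have g: "?g v \<in> mat_kernel A" "T (?g v) = v" if "v \<in> mat_kernel B" for v
    using that bij by (auto simp: bij_betw_def inv_into_into f_inv_into_f)
  have gT: "?g (T v) = v" if "v \<in> mat_kernel A" for v
    using that bij by (auto simp: bij_betw_def)
  interpret A: kernel k n A by unfold_locales (rule A)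
  show "?g (v + w) = ?g v + ?g w" if "v \<in> mat_kernel B" "w \<in> mat_kernel B" for v w
  proof -
    have "?g v + ?g w \<in> mat_kernel A"
      using A.Ker.add.m_closed g that by auto
    then show ?thesis
      using gT[of "?g v + ?g w"] add g that by simp
  qed
  show "?g (c \<cdot>\<^sub>v v) = c \<cdot>\<^sub>v ?g v" if "v \<in> mat_kernel B" for c v
    using gT[OF mat_kernel_smult[OF A], of "?g v" c] smult g that by simp
qed

lemma sorted_list_of_multiset_map_add:
  "sorted_list_of_multiset (image_mset (\<lambda>x. x + e) M) = map (\<lambda>x. x + e :: nat) (sorted_list_of_multiset M)"
proof -
  have "sorted (map (\<lambda>x. x + e) (sorted_list_of_multiset M))"
    using sorted_sorted_list_of_multiset[of M] by (simp add: sorted_map)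
  then have "map (\<lambda>x. x + e) (sorted_list_of_multiset M) = sort (map (\<lambda>x. x + e) (sorted_list_of_multiset M))"
    by (simp add: sorted_sort_id)
  then show ?thesis
    by (simp flip: sorted_list_of_multiset_mset)
qed

text \<open>Intended for the map that reads \<open>u\<close> off the null vector
  \<open>[\<Lambda> \<otimes> u; z]\<close>. Being a choice of entries, it is linear, makes sense
  for polynomials and rational functions alike, and commutes with \<open>fract_vec\<close>.\<close>

definition select_coords :: "nat \<Rightarrow> (nat \<Rightarrow> nat) \<Rightarrow> 'a vec \<Rightarrow> 'a vec" where
  "select_coords n f v = vec n (\<lambda>i. v $ f i)"

lemma fract_vec_select_coords:
  assumes "\<And>i. i < n \<Longrightarrow> f i < dim_vec v"
  shows "fract_vec (select_coords n f v) = select_coords n f (fract_vec v)"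
  using assms by (intro eq_vecI) (auto simp: select_coords_def)

text \<open>Every rational null vector is a nonzero scalar multiple of a polynomial one, and
  selection commutes with scaling, so bijectivity passes from polynomial null vectors to rational
  ones.\<close>

lemma select_coords_bij_fract_kernel:
  fixes P Q :: "'a::field poly mat"
  assumes P: "P \<in> carrier_mat k n" and Q: "Q \<in> carrier_mat l h"
    and f: "\<And>i. i < n \<Longrightarrow> f i < h"
    and bij: "bij_betw (select_coords n f) (mat_kernel Q) (mat_kernel P)"
  shows "bij_betw (select_coords n f) (mat_kernel (fract_mat Q)) (mat_kernel (fract_mat P))"
proof -
  have Q': "fract_mat Q \<in> carrier_mat l h" and P': "fract_mat P \<in> carrier_mat k n"
    using P Q by auto
  have dimQ: "dim_vec v = h" if "v \<in> mat_kernel (fract_mat Q)" for v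
    using mat_kernelD[OF Q' that] by auto
  have smult: "select_coords n f (c \<cdot>\<^sub>v v) = c \<cdot>\<^sub>v select_coords n f v"
    if "dim_vec v = h" for c and v :: "'a poly fract vec"
    using f that by (intro eq_vecI) (auto simp: select_coords_def)
  have lift: "\<exists>p u. p \<noteq> 0 \<and> u \<in> mat_kernel R \<and> fract_vec u = to_fract p \<cdot>\<^sub>v v"
    if v: "v \<in> mat_kernel (fract_mat R)" for R :: "'a poly mat" and v
  proof -
    obtain p u where pu: "p \<noteq> 0" "fract_vec u = to_fract p \<cdot>\<^sub>v v"
      using clear_denominators by blast
    have "fract_vec u \<in> mat_kernel (fract_mat R)"
      unfolding pu(2) by (rule mat_kernel_smult[OF _ v]) auto
    then have "u \<in> mat_kernel R"
      by (simp only: fract_vec_mem_kernel_iff)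
    then show ?thesis
      using pu by blast
  qed
  have scale_cancel: "v = w" if "to_fract p \<cdot>\<^sub>v v = to_fract p \<cdot>\<^sub>v w" "p \<noteq> 0"
    for p :: "'a poly" and v w :: "'a poly fract vec"
    using arg_cong[OF that(1), of "\<lambda>x. inverse (to_fract p) \<cdot>\<^sub>v x"] that(2)
    by (simp add: smult_smult_assoc)
  have smult_zero: "to_fract p \<cdot>\<^sub>v 0\<^sub>v j = 0\<^sub>v j" for p :: "'a poly" and j
    by (rule eq_vecI) auto
  show ?thesis
    unfolding bij_betw_def
  proof
    \<comment> \<open>Reducing injectivity to a trivial kernel leaves a single vector to be cleared
      of denominators instead of two.\<close>
    have ker0: "u = 0\<^sub>v h"
      if u: "u \<in> mat_kernel (fract_mat Q)" "select_coords n f u = 0\<^sub>v n" for u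
    proof -
      obtain p x where x: "p \<noteq> 0" "x \<in> mat_kernel Q" "fract_vec x = to_fract p \<cdot>\<^sub>v u"
        using lift[OF u(1)] by blast
      have dimx: "dim_vec x = h"
        using mat_kernelD[OF Q x(2)] by auto
      have "fract_vec (select_coords n f x) = to_fract p \<cdot>\<^sub>v 0\<^sub>v n"
        using fract_vec_select_coords[of n f x] f dimx x smult dimQ u by simp
      then have "select_coords n f x = 0\<^sub>v n"
        using to_fract_hom.vec_hom_zero_iff smult_zero by metis
      moreover have "select_coords n f (0\<^sub>v h) = (0\<^sub>v n :: 'a poly vec)"
        using f by (intro eq_vecI) (auto simp: select_coords_def)
      moreover have "0\<^sub>v h \<in> mat_kernel Q"
        using Q by (intro mat_kernelI[OF Q]) auto
      ultimately have "x = 0\<^sub>v h"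
        using inj_onD[OF bij_betw_imp_inj_on[OF bij], of x "0\<^sub>v h"] x(2) by simp
      then have "to_fract p \<cdot>\<^sub>v u = to_fract p \<cdot>\<^sub>v 0\<^sub>v h"
        using x(3) to_fract_hom.vec_hom_zero[of h] by (metis smult_zero)
      then show ?thesis
        using scale_cancel x(1) by blast
    qed
    show "inj_on (select_coords n f) (mat_kernel (fract_mat Q))"
    proof (rule inj_onI)
      fix v w
      assume v: "v \<in> mat_kernel (fract_mat Q)" and w: "w \<in> mat_kernel (fract_mat Q)"
        and eq: "select_coords n f v = select_coords n f w"
      have vw: "v \<in> carrier_vec h" "w \<in> carrier_vec h"
        using mat_kernelD[OF Q'] v w by auto
      have "v - w \<in> mat_kernel (fract_mat Q)"
        using mat_kernelD[OF Q' v] mat_kernelD[OF Q' w]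
        by (intro mat_kernelI[OF Q']) (auto simp: mult_minus_distrib_mat_vec[OF Q'])
      moreover have "select_coords n f (v - w) = 0\<^sub>v n"
      proof (rule eq_vecI)
        fix i assume i: "i < dim_vec (0\<^sub>v n)"
        then have "select_coords n f v $ i = select_coords n f w $ i" by (simp only: eq)
        then show "select_coords n f (v - w) $ i = 0\<^sub>v n $ i"
          using i f[of i] vw by (simp add: select_coords_def)
      qed (simp add: select_coords_def)
      ultimately have z: "v - w = 0\<^sub>v h" by (rule ker0)
      show "v = w"
      proof (rule eq_vecI)
        fix i assume i: "i < dim_vec w"
        have "(v - w) $ i = 0" using i vw by (simp add: z)
        then show "v $ i = w $ i" using i by simp
      qed (use vw in auto)
    qed
    show "select_coords n f ` mat_kernel (fract_mat Q) = mat_kernel (fract_mat P)"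
    proof (intro equalityI subsetI)
      fix y assume "y \<in> select_coords n f ` mat_kernel (fract_mat Q)"
      then obtain v where v: "v \<in> mat_kernel (fract_mat Q)" "y = select_coords n f v" by auto
      obtain p x where x: "p \<noteq> 0" "x \<in> mat_kernel Q" "fract_vec x = to_fract p \<cdot>\<^sub>v v"
        using lift[OF v(1)] by blast
      have dimx: "dim_vec x = h"
        using mat_kernelD[OF Q x(2)] by auto
      have "fract_vec (select_coords n f x) = to_fract p \<cdot>\<^sub>v y"
        using fract_vec_select_coords[of n f x] f dimx x smult dimQ v by simp
      moreover have "fract_vec (select_coords n f x) \<in> mat_kernel (fract_mat P)"
        using bij x by (auto simp: fract_vec_mem_kernel_iff bij_betw_def)
      ultimately have "inverse (to_fract p) \<cdot>\<^sub>v (to_fract p \<cdot>\<^sub>v y) \<in> mat_kernel (fract_mat P)"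
        using mat_kernel_smult[OF P'] by metis
      then show "y \<in> mat_kernel (fract_mat P)"
        using x(1) by (simp add: smult_smult_assoc)
    next
      fix y assume y: "y \<in> mat_kernel (fract_mat P)"
      obtain p x where x: "p \<noteq> 0" "x \<in> mat_kernel P" "fract_vec x = to_fract p \<cdot>\<^sub>v y"
        using lift[OF y] by blast
      have "x \<in> select_coords n f ` mat_kernel Q"
        using bij x(2) by (simp add: bij_betw_def)
      then obtain v where v: "v \<in> mat_kernel Q" "select_coords n f v = x"
        by blast
      have dimv: "dim_vec v = h"
        using mat_kernelD[OF Q v(1)] by auto
      let ?w = "inverse (to_fract p) \<cdot>\<^sub>v fract_vec v"
      have "?w \<in> mat_kernel (fract_mat Q)"
        using v by (intro mat_kernel_smult[OF Q']) (simp add: fract_vec_mem_kernel_iff)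
      moreover have "select_coords n f ?w = y"
      proof -
        have "select_coords n f ?w = inverse (to_fract p) \<cdot>\<^sub>v (to_fract p \<cdot>\<^sub>v y)"
          using fract_vec_select_coords[of n f v] f dimv v x(3) smult[of "fract_vec v"] by simp
        then show ?thesis
          using x(1) by (simp add: smult_smult_assoc)
      qed
      ultimately show "y \<in> select_coords n f ` mat_kernel (fract_mat Q)" by blast
    qed
  qed
qed

text \<open>Selecting coordinates maps minimal bases to minimal bases, because every polynomial basis
  on one side corresponds to one on the other side with all degrees shifted by \<open>e\<close>.\<close>

lemma right_minimal_indices_shift:
  fixes P Q :: "'a::field poly mat"
  assumes P: "P \<in> carrier_mat k n" and Q: "Q \<in> carrier_mat l h"
    and f: "\<And>i. i < n \<Longrightarrow> f i < h"
    and bij: "bij_betw (select_coords n f) (mat_kernel Q) (mat_kernel P)"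
    and deg: "\<And>v. v \<in> mat_kernel Q \<Longrightarrow> v \<noteq> 0\<^sub>v h \<Longrightarrow>
      vec_degree v = vec_degree (select_coords n f v) + e"
  shows "right_minimal_indices Q = map (\<lambda>\<alpha>. \<alpha> + e) (right_minimal_indices P)"
proof -
  let ?T = "select_coords n f"
  have Q': "fract_mat Q \<in> carrier_mat l h" and P': "fract_mat P \<in> carrier_mat k n"
    using P Q by auto
  interpret P: kernel k n "fract_mat P" by unfold_locales (rule P')
  interpret Q: kernel l h "fract_mat Q" by unfold_locales (rule Q')
  note bij' = select_coords_bij_fract_kernel[OF P Q f bij]
  have dimQ: "dim_vec v = h" if "v \<in> mat_kernel (fract_mat Q)" for v
    using mat_kernelD[OF Q' that] by auto
  have smult: "?T (c \<cdot>\<^sub>v v) = c \<cdot>\<^sub>v ?T v" if "v \<in> mat_kernel (fract_mat Q)" for c v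
    using f dimQ[OF that] by (intro eq_vecI) (auto simp: select_coords_def)
  have add: "?T (v + w) = ?T v + ?T w"
    if "v \<in> mat_kernel (fract_mat Q)" "w \<in> mat_kernel (fract_mat Q)" for v w
    using f dimQ[OF that(1)] dimQ[OF that(2)] by (intro eq_vecI) (auto simp: select_coords_def)
  have fract_T: "fract_vec (?T v) = ?T (fract_vec v)" if "v \<in> mat_kernel Q" for v
    using f mat_kernelD[OF Q that] by (intro fract_vec_select_coords) auto
  \<comment> \<open>The zero vector is excluded because \<open>deg\<close> speaks of nonzero vectors
    only.\<close>
  have basis_sub: "B \<subseteq> mat_kernel Q" "0\<^sub>v h \<notin> B"
    if "polynomial_basis h (mat_kernel (fract_mat Q)) B" for B
  proof -
    have b: "Q.basis (fract_vec ` B)"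
      using that by (simp add: polynomial_basis_kernel_iff[OF Q'])
    then have sub: "fract_vec ` B \<subseteq> mat_kernel (fract_mat Q)" and li: "Q.lin_indpt (fract_vec ` B)"
      by (auto simp: Q.Ker.basis_def)
    show "B \<subseteq> mat_kernel Q"
      using sub fract_vec_mem_kernel_iff by blast
    have "0\<^sub>v h \<notin> fract_vec ` B"
      using Q.Ker.vs_zero_lin_dep[OF sub li] by simp
    then show "0\<^sub>v h \<notin> B"
      using to_fract_hom.vec_hom_zero by (metis image_eqI)
  qed
  have sum_deg: "sum vec_degree B = sum vec_degree (?T ` B) + e * card B"
    if "polynomial_basis h (mat_kernel (fract_mat Q)) B" for B
  proof -
    have "inj_on ?T B"
      using inj_on_subset[OF bij_betw_imp_inj_on[OF bij] basis_sub(1)[OF that]] .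
    then have "sum vec_degree (?T ` B) + e * card B = (\<Sum>b\<in>B. vec_degree (?T b) + e)"
      by (simp add: sum.reindex sum.distrib)
    also have "\<dots> = sum vec_degree B"
      using deg basis_sub[OF that] by (intro sum.cong) (auto intro!: deg[symmetric])
    finally show ?thesis by simp
  qed
  have push: "polynomial_basis n (mat_kernel (fract_mat P)) (?T ` B)"
    if B: "polynomial_basis h (mat_kernel (fract_mat Q)) B" for B
  proof -
    have "P.basis (?T ` fract_vec ` B)"
      using B kernel_bij_image_basis[OF Q' P' bij' add smult]
      by (simp add: polynomial_basis_kernel_iff[OF Q'])
    also have "?T ` fract_vec ` B = fract_vec ` ?T ` B"
      unfolding image_image using basis_sub(1)[OF B] fract_T by (intro image_cong) auto
    finally show ?thesis
      using B by (simp add: polynomial_basis_kernel_iff[OF Q'] polynomial_basis_kernel_iff[OF P'])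
  qed
  \<comment> \<open>Polynomial vectors have polynomial preimages: on them the inverse
    \<open>?g'\<close> over the rational functions agrees with the inverse \<open>?g\<close> over
    the polynomials.\<close>
  have pull: "\<exists>B. polynomial_basis h (mat_kernel (fract_mat Q)) B \<and> ?T ` B = C"
    if C: "polynomial_basis n (mat_kernel (fract_mat P)) C" for C
  proof -
    let ?g = "inv_into (mat_kernel Q) ?T" and ?g' = "inv_into (mat_kernel (fract_mat Q)) ?T"
    have basis: "P.basis (fract_vec ` C)" and fin: "finite C"
      using C by (auto simp: polynomial_basis_kernel_iff[OF P'])
    then have "fract_vec ` C \<subseteq> mat_kernel (fract_mat P)"
      by (auto simp: P.Ker.basis_def)
    then have sub: "C \<subseteq> mat_kernel P"
      using fract_vec_mem_kernel_iff by blast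
    have g: "?g c \<in> mat_kernel Q" "?T (?g c) = c" if "c \<in> C" for c
      using that sub bij by (auto simp: bij_betw_def inv_into_into f_inv_into_f)
    have "?g' (fract_vec c) = fract_vec (?g c)" if "c \<in> C" for c
    proof (rule inv_into_f_eq)
      show "inj_on ?T (mat_kernel (fract_mat Q))"
        using bij' by (auto simp: bij_betw_def)
      show "fract_vec (?g c) \<in> mat_kernel (fract_mat Q)"
        using g[OF that] by (simp add: fract_vec_mem_kernel_iff)
      show "?T (fract_vec (?g c)) = fract_vec c"
        using fract_T[OF g(1)[OF that]] g(2)[OF that] by simp
    qed
    then have "?g' ` fract_vec ` C = fract_vec ` ?g ` C"
      unfolding image_image by (intro image_cong) auto
    then have "polynomial_basis h (mat_kernel (fract_mat Q)) (?g ` C)"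
      using fin kernel_bij_inv_image_basis[OF Q' P' bij' add smult basis]
      by (simp add: polynomial_basis_kernel_iff[OF Q'])
    moreover have "?T ` ?g ` C = C"
      using g by (force simp: image_image)
    ultimately show ?thesis by blast
  qed
  \<comment> \<open>All polynomial bases have \<open>dim\<close> many elements, so the total shift
    \<open>e * card B\<close> in \<open>sum_deg\<close> is the same for all of them and comparisons
    of degree sums carry over.\<close>
  have card_eq: "card B = card C"
    if "polynomial_basis h (mat_kernel (fract_mat Q)) B" "polynomial_basis h (mat_kernel (fract_mat Q)) C" for B C
  proof -
    have "Q.dim = card X" if "polynomial_basis h (mat_kernel (fract_mat Q)) X" for X
    proof -
      have "Q.dim = card (fract_vec ` X)"
        using that by (intro Q.Ker.dim_basis) (auto simp: polynomial_basis_kernel_iff[OF Q'])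
      also have "\<dots> = card X"
        by (rule card_image) (rule inj_on_subset[OF inj_fract_vec], simp)
      finally show ?thesis .
    qed
    then show ?thesis using that by metis
  qed
  obtain B where B: "minimal_basis h (mat_kernel (fract_mat Q)) B"
    using exists_minimal_basis[OF Q'] ..
  then have pB: "polynomial_basis h (mat_kernel (fract_mat Q)) B"
    by (simp add: minimal_basis_def)
  have "minimal_basis n (mat_kernel (fract_mat P)) (?T ` B)"
    unfolding minimal_basis_def
  proof (intro conjI allI impI)
    fix C assume "polynomial_basis n (mat_kernel (fract_mat P)) C"
    then obtain D where D: "polynomial_basis h (mat_kernel (fract_mat Q)) D" "?T ` D = C"
      using pull by blast
    have "sum vec_degree B \<le> sum vec_degree D"
      using B D by (simp add: minimal_basis_def)
    then show "sum vec_degree (?T ` B) \<le> sum vec_degree C"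
      using sum_deg[OF pB] sum_deg[OF D(1)] card_eq[OF pB D(1)] D(2) by simp
  qed (rule push[OF pB])
  from minimal_indices_eqI[OF P' this] have minP:
    "right_minimal_indices P = sorted_list_of_multiset (image_mset vec_degree (mset_set (?T ` B)))"
    using P by (simp add: right_minimal_indices_def right_null_space_def)
  have inj: "inj_on ?T B"
    using inj_on_subset[OF bij_betw_imp_inj_on[OF bij] basis_sub(1)[OF pB]] .
  have "image_mset vec_degree (mset_set B) = image_mset (\<lambda>b. vec_degree (?T b) + e) (mset_set B)"
    using pB basis_sub[OF pB] by (intro image_mset_cong) (auto simp: polynomial_basis_def intro!: deg)
  also have "\<dots> = image_mset (\<lambda>x. x + e) (image_mset vec_degree (mset_set (?T ` B)))"
    using inj by (simp add: image_mset_mset_set[symmetric] multiset.map_comp comp_def)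
  finally have "right_minimal_indices Q =
    sorted_list_of_multiset (image_mset (\<lambda>x. x + e) (image_mset vec_degree (mset_set (?T ` B))))"
    using minimal_indices_eqI[OF Q' B] Q by (simp add: right_minimal_indices_def right_null_space_def)
  then show ?thesis
    by (simp only: minP sorted_list_of_multiset_map_add)
qed

subsection \<open>Block Kronecker pencils\<close>

text \<open>The block row with \<open>L_\<epsilon>\<close> imposes this recurrence on the blocks of
  a null vector, so the last block determines the others.\<close>

lemma geometric_recurrence_iff:
  fixes y :: "nat \<Rightarrow> 'a::comm_ring_1"
  shows "(\<forall>a<k. y a = t * y (a + 1)) \<longleftrightarrow> (\<forall>a\<le>k. y a = t ^ (k - a) * y k)"
proof (intro iffI allI impI)
  fix a assume rec: "\<forall>a<k. y a = t * y (a + 1)" and "a \<le> k"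
  from \<open>a \<le> k\<close> show "y a = t ^ (k - a) * y k"
  proof (induction rule: inc_induct)
    case (step b)
    then have "y b = t * (t ^ (k - Suc b) * y k)"
      using rec by simp
    also have "\<dots> = t ^ Suc (k - Suc b) * y k"
      by (simp add: mult.assoc)
    finally show ?case
      using step by (simp add: Suc_diff_Suc)
  qed simp
next
  fix a assume eq: "\<forall>a\<le>k. y a = t ^ (k - a) * y k" and a: "a < k"
  have "y a = t ^ Suc (k - (a + 1)) * y k"
    using eq[rule_format, of a] a by (simp only: Suc_diff_Suc add_Suc_right add_0_right One_nat_def less_imp_le)
  also have "\<dots> = t * (t ^ (k - (a + 1)) * y k)"
    by (simp add: mult.assoc)
  also have "t ^ (k - (a + 1)) * y k = y (a + 1)"
    by (rule eq[rule_format, symmetric]) (use a in simp)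
  finally show "y a = t * y (a + 1)" .
qed

text \<open>\<open>S\<close> obeys Horner's rule \<open>S (a + 1) = t * S a + w (a + 1)\<close>. The
  equations with \<open>a < k\<close> solve for \<open>z a\<close>; the equation at
  \<open>a = k\<close> contains no new unknown and becomes the condition
  \<open>S k = 0\<close>.\<close>

lemma horner_recurrence_iff:
  fixes w z :: "nat \<Rightarrow> 'a::comm_ring_1" and t :: 'a
  defines "S \<equiv> (\<lambda>a. \<Sum>l = 0..<a + 1. t ^ (a - l) * w l)"
  shows "(\<forall>a\<le>k. w a + (if a < k then - z a else 0) + (if 0 < a then t * z (a - 1) else 0) = 0)
    \<longleftrightarrow> (\<forall>a<k. z a = S a) \<and> S k = 0"
proof -
  have S0: "S 0 = w 0"
    by (simp add: S_def)
  have S_Suc: "S (Suc a) = t * S a + w (Suc a)" for a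
  proof -
    have "(\<Sum>l = 0..<a + 1. t ^ (Suc a - l) * w l) = t * S a"
      unfolding S_def sum_distrib_left
      by (intro sum.cong refl) (auto simp: Suc_diff_le mult.assoc)
    then show ?thesis by (simp add: S_def)
  qed
  show ?thesis
  proof (intro iffI conjI allI impI)
    assume eq: "\<forall>a\<le>k. w a + (if a < k then - z a else 0) + (if 0 < a then t * z (a - 1) else 0) = 0"
    show z: "z a = S a" if "a < k" for a
      using that
    proof (induction a)
      case 0
      then show ?case using eq[rule_format, of 0] by (simp add: S0)
    next
      case (Suc a)
      then show ?case
        using eq[rule_format, of "Suc a"] by (simp add: S_Suc algebra_simps)
    qed
    show "S k = 0"
    proof (cases k)
      case 0
      then show ?thesis using eq[rule_format, of 0] by (simp add: S0)
    next
      case (Suc j)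
      then show ?thesis using eq[rule_format, of k] z[of j] by (simp add: S_Suc algebra_simps)
    qed
  next
    fix a assume "(\<forall>a<k. z a = S a) \<and> S k = 0" and "a \<le> k"
    then show "w a + (if a < k then - z a else 0) + (if 0 < a then t * z (a - 1) else 0) = 0"
      using S0 S_Suc[of "a - 1"] by (cases a; cases "a < k") (auto simp: algebra_simps)
  qed
qed

text \<open>Bundles the hypotheses so that they can be instantiated a second time with all data
  transposed.\<close>

locale block_kronecker_form =
  fixes P :: "'a::field poly mat" and M0 M1 :: "'a mat" and m n d \<epsilon> \<eta> :: nat
  assumes P: "P \<in> carrier_mat m n" and grade: "has_grade d P"
    and M0: "M0 \<in> carrier_mat ((\<eta> + 1) * m) ((\<epsilon> + 1) * n)"
    and M1: "M1 \<in> carrier_mat ((\<eta> + 1) * m) ((\<epsilon> + 1) * n)"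
    and d: "\<epsilon> + \<eta> + 1 = d"
    and antidiag: "\<And>k. k \<le> d \<Longrightarrow>
      antidiag_block_sum \<epsilon> n \<eta> m M1 (d + 2 - k) + antidiag_block_sum \<epsilon> n \<eta> m M0 (d + 1 - k)
        = coeff_mat P k"
begin

section \<open>Strong linearization from the antidiagonal sum condition\<close>

lemma coeff_entry:
  assumes rc: "r < m" "c < n" and k: "k \<le> d"
  shows "coeff (P $$ (r, c)) k = (\<Sum>a = 0..<\<eta> + 1. \<Sum>b = 0..<\<epsilon> + 1.
    (if a + b + k = d then M1 $$ (a * m + r, b * n + c) else 0) +
    (if a + b + 1 + k = d then M0 $$ (a * m + r, b * n + c) else 0))"
proof -
  have "coeff (P $$ (r, c)) k = coeff_mat P k $$ (r, c)"
    using P rc by (simp add: coeff_mat_def)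
  also have "\<dots> = antidiag_block_sum \<epsilon> n \<eta> m M1 (d + 2 - k) $$ (r, c)
      + antidiag_block_sum \<epsilon> n \<eta> m M0 (d + 1 - k) $$ (r, c)"
    using antidiag[OF k] rc antidiag_block_sum_carrier[of \<epsilon> n \<eta> m M0 "d + 1 - k"]
    by (metis carrier_matD index_add_mat(1))
  also have "\<dots> = (\<Sum>a = 0..<\<eta> + 1. \<Sum>b = 0..<\<epsilon> + 1.
    (if a + b + k = d then M1 $$ (a * m + r, b * n + c) else 0) +
    (if a + b + 1 + k = d then M0 $$ (a * m + r, b * n + c) else 0))"
    unfolding antidiag_block_sum_index[OF rc] sum.distrib[symmetric]
    using k by (intro sum.cong refl arg_cong2[of _ _ _ _ "(+)"] if_cong) auto
  finally show ?thesis .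
qed

text \<open>The subtractions in the exponents are exact because \<open>a + b\<close> is at most
  \<open>\<eta> + \<epsilon> = d - 1\<close>. Above degree \<open>d\<close> the grade of
  \<open>P\<close> makes the left side vanish, and no exponent on the right exceeds
  \<open>d\<close>.\<close>

lemma entry_eq:
  assumes rc: "r < m" "c < n"
  shows "P $$ (r, c) = (\<Sum>a = 0..<\<eta> + 1. \<Sum>b = 0..<\<epsilon> + 1.
    monom (M1 $$ (a * m + r, b * n + c)) (d - a - b) + monom (M0 $$ (a * m + r, b * n + c)) (d - 1 - a - b))"
    (is "_ = ?R")
proof (rule poly_eqI)
  fix k
  show "coeff (P $$ (r, c)) k = coeff ?R k"
  proof (cases "k \<le> d")
    case True
    show ?thesis
      unfolding coeff_entry[OF rc True] coeff_sum coeff_add coeff_monom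
      using d True by (intro sum.cong refl arg_cong2[of _ _ _ _ "(+)"] if_cong) auto
  next
    case False
    have "degree (P $$ (r, c)) \<le> d"
      using grade P rc by (auto simp: has_grade_def)
    then have "coeff (P $$ (r, c)) k = 0"
      using False by (intro coeff_eq_0) auto
    moreover have "coeff ?R k = 0"
      unfolding coeff_sum coeff_add coeff_monom using False by (intro sum.neutral ballI) auto
    ultimately show ?thesis by simp
  qed
qed

text \<open>Coefficient \<open>k\<close> of the reversal is coefficient \<open>d - k\<close> of
  \<open>P\<close>, so the exponents are the complements in \<open>d\<close> of those in
  \<open>entry_eq\<close>.\<close>

lemma rev_entry_eq:
  assumes rc: "r < m" "c < n"
  shows "rev_mat d P $$ (r, c) = (\<Sum>a = 0..<\<eta> + 1. \<Sum>b = 0..<\<epsilon> + 1.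
    monom (M1 $$ (a * m + r, b * n + c)) (a + b) + monom (M0 $$ (a * m + r, b * n + c)) (a + b + 1))"
    (is "_ = ?R")
proof (rule poly_eqI)
  fix k
  have "coeff (rev_mat d P $$ (r, c)) k = (\<Sum>i\<le>d. if d - i = k then coeff (P $$ (r, c)) i else 0)"
    using P rc by (simp add: rev_mat_def coeff_sum)
  also have "\<dots> = (\<Sum>i\<le>d. if i = d - k \<and> k \<le> d then coeff (P $$ (r, c)) i else 0)"
    by (intro sum.cong refl if_cong) auto
  also have "\<dots> = (if k \<le> d then coeff (P $$ (r, c)) (d - k) else 0)"
    by (cases "k \<le> d") auto
  also have "\<dots> = coeff ?R k"
  proof (cases "k \<le> d")
    case True
    then have "(if k \<le> d then coeff (P $$ (r, c)) (d - k) else 0) = coeff (P $$ (r, c)) (d - k)"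
      by simp
    also have "\<dots> = coeff ?R k"
      unfolding coeff_entry[OF rc diff_le_self] coeff_sum coeff_add coeff_monom
      using True by (intro sum.cong refl arg_cong2[of _ _ _ _ "(+)"] if_cong) auto
    finally show ?thesis .
  next
    case False
    moreover have "coeff ?R k = 0"
      unfolding coeff_sum coeff_add coeff_monom using False d by (intro sum.neutral ballI) auto
    ultimately show ?thesis by simp
  qed
  finally show "coeff (rev_mat d P $$ (r, c)) k = coeff ?R k" .
qed

lemma pencil_index:
  assumes "i < (\<eta> + 1) * m" "j < (\<epsilon> + 1) * n"
  shows "pencil M1 M0 $$ (i, j) = monom (M1 $$ (i, j)) 1 + monom (M0 $$ (i, j)) 0"
  using M0 M1 assms by (simp add: pencil_def monom_altdef)

lemma rev_pencil_index:
  assumes "i < (\<eta> + 1) * m" "j < (\<epsilon> + 1) * n"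
  shows "pencil M0 M1 $$ (i, j) = monom (M1 $$ (i, j)) 0 + monom (M0 $$ (i, j)) 1"
  using M0 M1 assms by (simp add: pencil_def monom_altdef)

text \<open>The factorization of \<open>P\<close> through the pencil, by entries: the coefficient of
  \<open>M1\<close> has exponent \<open>(\<eta> - a) + 1 + (\<epsilon> - b) = d - a - b\<close>,
  that of \<open>M0\<close> one less.\<close>

lemma entry_eq_pencil:
  assumes rc: "r < m" "c < n"
  shows "P $$ (r, c) = (\<Sum>a = 0..<\<eta> + 1. \<Sum>b = 0..<\<epsilon> + 1.
    monom 1 (\<eta> - a) * pencil M1 M0 $$ (a * m + r, b * n + c) * monom 1 (\<epsilon> - b))"
  unfolding entry_eq[OF rc]
proof (intro sum.cong refl, goal_cases)
  case (1 a b)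
  then have ab: "a \<le> \<eta>" "b \<le> \<epsilon>" by auto
  have "\<eta> - a + 1 + (\<epsilon> - b) = d - a - b" "\<eta> - a + (\<epsilon> - b) = d - 1 - a - b"
    using ab d by auto
  then show ?case
    using ab pencil_index[OF block_index_less[OF ab(1) rc(1)] block_index_less[OF ab(2) rc(2)]]
    by (simp add: mult_monom distrib_left distrib_right)
qed

lemma linearization: "is_linearization (block_kronecker_pencil \<epsilon> n \<eta> m M1 M0) P"
proof -
  have c: "L_pencil k \<in> carrier_mat k (k + 1)" "L_completion k \<in> carrier_mat (k + 1) (k + 1)" for k
    by (simp_all add: L_pencil_def L_completion_def)
  have inv: "\<exists>H \<in> carrier_mat (k + 1) (k + 1). H * L_completion k = (1\<^sub>m (k + 1) :: 'a poly mat)" for k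
    by (rule append_unit_row_inverse[OF c L_pencil_times_completion, of k])
      (auto simp: L_completion_def)
  obtain H H' :: "'a poly mat" where
    H: "H \<in> carrier_mat (\<epsilon> + 1) (\<epsilon> + 1)" "H * L_completion \<epsilon> = 1\<^sub>m (\<epsilon> + 1)" and
    H': "H' \<in> carrier_mat (\<eta> + 1) (\<eta> + 1)" "H' * L_completion \<eta> = 1\<^sub>m (\<eta> + 1)"
    using inv by meson
  have M: "pencil M1 M0 \<in> carrier_mat ((\<eta> + 1) * m) ((\<epsilon> + 1) * n)"
    using M0 M1 by (simp add: pencil_def)
  have "unimod_equiv (block_kronecker_pencil \<epsilon> n \<eta> m M1 M0)
    (four_block_mat (1\<^sub>m (\<eta> * m + \<epsilon> * n)) (0\<^sub>m (\<eta> * m + \<epsilon> * n) n) (0\<^sub>m m (\<eta> * m + \<epsilon> * n)) P)"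
    unfolding block_kronecker_pencil_def
  proof (rule unimod_equiv_kronecker[OF M c(1) c(1) c(2) c(2) H(1) H'(1) H(2) H'(2)
      L_pencil_times_completion L_pencil_times_completion P])
    fix r c assume rc: "r < m" "c < n"
    show "P $$ (r, c) = (\<Sum>a = 0..<\<eta> + 1. \<Sum>b = 0..<\<epsilon> + 1. L_completion \<eta> $$ (a, \<eta>) *
      pencil M1 M0 $$ (a * m + r, b * n + c) * L_completion \<epsilon> $$ (b, \<epsilon>))"
      unfolding entry_eq_pencil[OF rc] by (intro sum.cong refl) (auto simp: L_completion_def)
  qed
  moreover have "has_grade 1 (block_kronecker_pencil \<epsilon> n \<eta> m M1 M0)"
    by (rule has_grade_block_kronecker_pencil[OF M0 M1])
  ultimately show ?thesis
    using P unfolding is_linearization_def unimod_equiv_def by auto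
qed

lemma rev_linearization:
  "is_linearization (rev_mat 1 (block_kronecker_pencil \<epsilon> n \<eta> m M1 M0)) (rev_mat d P)"
proof -
  have c: "rev_mat 1 (L_pencil k) \<in> carrier_mat k (k + 1)"
    "rev_L_completion k \<in> carrier_mat (k + 1) (k + 1)" for k
    by (simp_all add: rev_mat_def L_pencil_def rev_L_completion_def)
  \<comment> \<open>For the reversed completion it is row 0 that is the unit row
    \<open>(0, ..., 0, 1)\<close>.\<close>
  have inv: "\<exists>H \<in> carrier_mat (k + 1) (k + 1). H * rev_L_completion k = (1\<^sub>m (k + 1) :: 'a poly mat)" for k
    by (rule append_unit_row_inverse[OF c rev_L_pencil_times_completion, of 0])
      (auto simp: rev_L_completion_def)
  obtain H H' :: "'a poly mat" where
    H: "H \<in> carrier_mat (\<epsilon> + 1) (\<epsilon> + 1)" "H * rev_L_completion \<epsilon> = 1\<^sub>m (\<epsilon> + 1)" and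
    H': "H' \<in> carrier_mat (\<eta> + 1) (\<eta> + 1)" "H' * rev_L_completion \<eta> = 1\<^sub>m (\<eta> + 1)"
    using inv by meson
  have M: "pencil M0 M1 \<in> carrier_mat ((\<eta> + 1) * m) ((\<epsilon> + 1) * n)"
    using M0 M1 by (simp add: pencil_def)
  have revP: "rev_mat d P \<in> carrier_mat m n"
    using P by (simp add: rev_mat_def)
  have "unimod_equiv (rev_mat 1 (block_kronecker_pencil \<epsilon> n \<eta> m M1 M0))
    (four_block_mat (1\<^sub>m (\<eta> * m + \<epsilon> * n)) (0\<^sub>m (\<eta> * m + \<epsilon> * n) n) (0\<^sub>m m (\<eta> * m + \<epsilon> * n)) (rev_mat d P))"
    unfolding rev_mat_block_kronecker_pencil[OF M0 M1]
  proof (rule unimod_equiv_kronecker[OF M c(1) c(1) c(2) c(2) H(1) H'(1) H(2) H'(2)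
      rev_L_pencil_times_completion rev_L_pencil_times_completion revP])
    fix r c assume rc: "r < m" "c < n"
    show "rev_mat d P $$ (r, c) = (\<Sum>a = 0..<\<eta> + 1. \<Sum>b = 0..<\<epsilon> + 1. rev_L_completion \<eta> $$ (a, \<eta>) *
      pencil M0 M1 $$ (a * m + r, b * n + c) * rev_L_completion \<epsilon> $$ (b, \<epsilon>))"
      unfolding rev_entry_eq[OF rc]
    proof (intro sum.cong refl, goal_cases)
      case (1 a b)
      then have ab: "a \<le> \<eta>" "b \<le> \<epsilon>" by auto
      then show ?case
        using rev_pencil_index[OF block_index_less[OF _ rc(1)] block_index_less[OF _ rc(2)]]
        by (simp add: rev_L_completion_def mult_monom distrib_left distrib_right add.commute)
    qed
  qed
  then show ?thesis
    using revP has_grade_rev_mat[of 1 "block_kronecker_pencil \<epsilon> n \<eta> m M1 M0"]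
    unfolding is_linearization_def unimod_equiv_def by auto
qed

lemma strong_linearization:
  "is_strong_linearization d (block_kronecker_pencil \<epsilon> n \<eta> m M1 M0) P"
  using grade linearization rev_linearization by (simp add: is_strong_linearization_def)

section \<open>The polynomial null space of the pencil\<close>

abbreviation "\<L> \<equiv> block_kronecker_pencil \<epsilon> n \<eta> m M1 M0"
abbreviation "M \<equiv> pencil M1 M0"
text \<open>The Horner sums of the blocks of \<open>M y\<close>: they are the values forced on the
  blocks of \<open>z\<close>, and the last one is the remaining condition.\<close>

abbreviation "S y a r \<equiv> (\<Sum>l = 0..<a + 1. [:0, 1:] ^ (a - l) * (M *\<^sub>v y) $ (l * m + r))"
text \<open>The last block of \<open>y\<close>, where the column
  \<open>[x^\<epsilon>, ..., x, 1]\<close> has entry 1, so that \<open>u\<close> itself is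
  returned.\<close>

abbreviation "proj \<equiv> select_coords n (\<lambda>i. \<epsilon> * n + i)"

lemma M_carrier: "M \<in> carrier_mat ((\<eta> + 1) * m) ((\<epsilon> + 1) * n)"
  using M0 M1 by (simp add: pencil_def)

lemma L_carrier: "\<L> \<in> carrier_mat ((\<eta> + 1) * m + \<epsilon> * n) ((\<epsilon> + 1) * n + \<eta> * m)"
  using M_carrier unfolding block_kronecker_pencil_def by (intro four_block_carrier_mat) auto

text \<open>This form relates neighbouring blocks and is the one that yields the degree bounds;
  \<open>kernel_iff\<close> solves it.\<close>

lemma kernel_equations:
  assumes y: "y \<in> carrier_vec ((\<epsilon> + 1) * n)" and z: "z \<in> carrier_vec (\<eta> * m)"
  shows "y @\<^sub>v z \<in> mat_kernel \<L> \<longleftrightarrow>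
    (\<forall>a<\<epsilon>. \<forall>c<n. y $ (a * n + c) = [:0, 1:] * y $ ((a + 1) * n + c)) \<and>
    (\<forall>a\<le>\<eta>. \<forall>r<m. (M *\<^sub>v y) $ (a * m + r) + (if a < \<eta> then - z $ (a * m + r) else 0)
      + (if 0 < a then [:0, 1:] * z $ ((a - 1) * m + r) else 0) = 0)"
    (is "_ \<longleftrightarrow> ?A \<and> ?B")
proof -
  let ?E = "L_pencil \<epsilon> \<otimes>\<^sub>k 1\<^sub>m n :: 'a poly mat" and ?H = "(L_pencil \<eta>)\<^sup>T \<otimes>\<^sub>k 1\<^sub>m m :: 'a poly mat"
  have E: "?E \<in> carrier_mat (\<epsilon> * n) ((\<epsilon> + 1) * n)" and H: "?H \<in> carrier_mat ((\<eta> + 1) * m) (\<eta> * m)"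
    by (auto simp: L_pencil_def intro!: carrier_matI)
  have Z: "0\<^sub>m (\<epsilon> * n) (\<eta> * m) *\<^sub>v z = 0\<^sub>v (\<epsilon> * n)"
    using z by (intro eq_vecI) auto
  have "\<L> *\<^sub>v (y @\<^sub>v z) = (M *\<^sub>v y + ?H *\<^sub>v z) @\<^sub>v (?E *\<^sub>v y + 0\<^sub>m (\<epsilon> * n) (\<eta> * m) *\<^sub>v z)"
    unfolding block_kronecker_pencil_def
    by (rule four_block_mat_mult_vec[OF M_carrier H E _ y z]) auto
  also have "\<dots> = (M *\<^sub>v y + ?H *\<^sub>v z) @\<^sub>v (?E *\<^sub>v y)"
    unfolding Z using E by (simp add: right_zero_vec[of _ "\<epsilon> * n"] mult_mat_vec_carrier[OF E y])
  finally have mult: "\<L> *\<^sub>v (y @\<^sub>v z) = (M *\<^sub>v y + ?H *\<^sub>v z) @\<^sub>v (?E *\<^sub>v y)" .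
  have zero: "0\<^sub>v ((\<eta> + 1) * m + \<epsilon> * n) = 0\<^sub>v ((\<eta> + 1) * m) @\<^sub>v (0\<^sub>v (\<epsilon> * n) :: 'a poly vec)"
    by (rule eq_vecI) auto
  have c: "M *\<^sub>v y + ?H *\<^sub>v z \<in> carrier_vec ((\<eta> + 1) * m)"
    using M_carrier y H z by (intro add_carrier_vec mult_mat_vec_carrier) auto
  have "y @\<^sub>v z \<in> mat_kernel \<L> \<longleftrightarrow> \<L> *\<^sub>v (y @\<^sub>v z) = 0\<^sub>v ((\<eta> + 1) * m + \<epsilon> * n)"
    using append_carrier_vec[OF y z] by (simp only: mat_kernel[OF L_carrier] mem_Collect_eq simp_thms)
  also have "\<dots> \<longleftrightarrow> M *\<^sub>v y + ?H *\<^sub>v z = 0\<^sub>v ((\<eta> + 1) * m) \<and> ?E *\<^sub>v y = 0\<^sub>v (\<epsilon> * n)"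
    unfolding mult zero by (rule append_vec_eq[OF c]) simp
  also have "?E *\<^sub>v y = 0\<^sub>v (\<epsilon> * n) \<longleftrightarrow> (\<forall>k<\<epsilon> * n. (?E *\<^sub>v y) $ k = 0)"
    using mult_mat_vec_carrier[OF E y] by (auto simp: vec_eq_iff)
  also have "\<dots> \<longleftrightarrow> ?A"
  proof -
    have "(?E *\<^sub>v y) $ (a * n + c) = 0 \<longleftrightarrow> y $ (a * n + c) = [:0, 1:] * y $ ((a + 1) * n + c)"
      if "a < \<epsilon>" "c < n" for a c
      using L_pencil_mult_vec_index[of y \<epsilon> n a c] y that by (auto simp: add_eq_0_iff)
    then show ?thesis
      unfolding all_block_index_iff by blast
  qed
  also have "M *\<^sub>v y + ?H *\<^sub>v z = 0\<^sub>v ((\<eta> + 1) * m) \<longleftrightarrow>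
      (\<forall>k<(\<eta> + 1) * m. (M *\<^sub>v y) $ k + (?H *\<^sub>v z) $ k = 0)"
    using M_carrier H by (auto simp: vec_eq_iff L_pencil_def)
  also have "\<dots> \<longleftrightarrow> ?B"
  proof -
    have "(M *\<^sub>v y) $ (a * m + r) + (?H *\<^sub>v z) $ (a * m + r) =
      (M *\<^sub>v y) $ (a * m + r) + (if a < \<eta> then - z $ (a * m + r) else 0)
        + (if 0 < a then [:0, 1:] * z $ ((a - 1) * m + r) else 0)" if "a \<le> \<eta>" "r < m" for a r
      using transpose_L_pencil_mult_vec_index[of z \<eta> m a r] z that by (simp only: add.assoc carrier_vecD)
    from arg_cong[of _ _ "\<lambda>p. p = 0", OF this]
    have "(M *\<^sub>v y) $ (a * m + r) + (?H *\<^sub>v z) $ (a * m + r) = 0 \<longleftrightarrow>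
      (M *\<^sub>v y) $ (a * m + r) + (if a < \<eta> then - z $ (a * m + r) else 0)
        + (if 0 < a then [:0, 1:] * z $ ((a - 1) * m + r) else 0) = 0" if "a \<le> \<eta>" "r < m" for a r
      using that .
    note eq = this
    have cong: "(\<forall>a<\<eta> + 1. \<forall>r<m. R a r) \<longleftrightarrow> (\<forall>a\<le>\<eta>. \<forall>r<m. T a r)"
      if "\<And>a r. a \<le> \<eta> \<Longrightarrow> r < m \<Longrightarrow> R a r \<longleftrightarrow> T a r" for R T :: "nat \<Rightarrow> nat \<Rightarrow> bool"
      using that by (auto simp: less_Suc_eq_le)
    show ?thesis
      unfolding all_block_index_iff by (rule cong) (rule eq)
  qed
  finally show ?thesis by blast
qed

text \<open>For each fixed position inside the blocks, the equations form one geometric or one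
  Horner recurrence over the block number; the quantifiers are swapped to expose them.\<close>

lemma kernel_iff:
  assumes y: "y \<in> carrier_vec ((\<epsilon> + 1) * n)" and z: "z \<in> carrier_vec (\<eta> * m)"
  shows "y @\<^sub>v z \<in> mat_kernel \<L> \<longleftrightarrow>
    (\<forall>a\<le>\<epsilon>. \<forall>c<n. y $ (a * n + c) = [:0, 1:] ^ (\<epsilon> - a) * y $ (\<epsilon> * n + c)) \<and>
    (\<forall>a<\<eta>. \<forall>r<m. z $ (a * m + r) = S y a r) \<and> (\<forall>r<m. S y \<eta> r = 0)"
proof -
  have swap: "(\<forall>a<\<epsilon>. \<forall>c<n. R a c) \<longleftrightarrow> (\<forall>c<n. \<forall>a<\<epsilon>. R a c)"
    "(\<forall>a\<le>\<epsilon>. \<forall>c<n. R a c) \<longleftrightarrow> (\<forall>c<n. \<forall>a\<le>\<epsilon>. R a c)" for R :: "nat \<Rightarrow> nat \<Rightarrow> bool"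
    by blast+
  have swap': "(\<forall>a\<le>\<eta>. \<forall>r<m. R a r) \<longleftrightarrow> (\<forall>r<m. \<forall>a\<le>\<eta>. R a r)"
    "(\<forall>a<\<eta>. \<forall>r<m. R a r) \<and> (\<forall>r<m. T r) \<longleftrightarrow> (\<forall>r<m. (\<forall>a<\<eta>. R a r) \<and> T r)"
    for R :: "nat \<Rightarrow> nat \<Rightarrow> bool" and T
    by blast+
  show ?thesis
    unfolding kernel_equations[OF y z] swap swap'
      geometric_recurrence_iff[of \<epsilon> "\<lambda>a. y $ (a * n + c)" for c]
      horner_recurrence_iff[of \<eta> "\<lambda>a. (M *\<^sub>v y) $ (a * m + r)" "\<lambda>a. z $ (a * m + r)" for r] ..
qed

text \<open>For \<open>y = \<Lambda> \<otimes> u\<close> the last Horner sum multiplies the pencil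
  by the columns of powers on both sides, which gives \<open>P\<close> by
  \<open>entry_eq_pencil\<close>. So the leftover condition of \<open>kernel_iff\<close> is
  \<open>P u = 0\<close>.\<close>

lemma S_top:
  assumes y: "y \<in> carrier_vec ((\<epsilon> + 1) * n)" and u: "u \<in> carrier_vec n"
    and yu: "\<And>b c. b \<le> \<epsilon> \<Longrightarrow> c < n \<Longrightarrow> y $ (b * n + c) = [:0, 1:] ^ (\<epsilon> - b) * u $ c"
    and r: "r < m"
  shows "S y \<eta> r = (P *\<^sub>v u) $ r"
proof -
  let ?x = "[:0, 1:] :: 'a poly"
  have x: "monom 1 k = ?x ^ k" for k
    by (simp add: monom_altdef)
  have My: "(M *\<^sub>v y) $ (a * m + r) =
    (\<Sum>b = 0..<\<epsilon> + 1. \<Sum>c = 0..<n. M $$ (a * m + r, b * n + c) * (?x ^ (\<epsilon> - b) * u $ c))"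
    if a: "a \<le> \<eta>" for a
  proof -
    have "(M *\<^sub>v y) $ (a * m + r) = (\<Sum>j = 0..<(\<epsilon> + 1) * n. M $$ (a * m + r, j) * y $ j)"
      using M_carrier y block_index_less[OF a r] by (auto simp: scalar_prod_def)
    also have "\<dots> = (\<Sum>b = 0..<\<epsilon> + 1. \<Sum>c = 0..<n. M $$ (a * m + r, b * n + c) * y $ (b * n + c))"
      by (rule sum_blocks)
    also have "\<dots> = (\<Sum>b = 0..<\<epsilon> + 1. \<Sum>c = 0..<n. M $$ (a * m + r, b * n + c) * (?x ^ (\<epsilon> - b) * u $ c))"
      by (intro sum.cong refl arg_cong2[of _ _ _ _ "(*)"] yu) auto
    finally show ?thesis .
  qed
  have "(P *\<^sub>v u) $ r = (\<Sum>c = 0..<n. P $$ (r, c) * u $ c)"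
    using P u r by (auto simp: scalar_prod_def)
  also have "\<dots> = (\<Sum>c = 0..<n. \<Sum>a = 0..<\<eta> + 1. \<Sum>b = 0..<\<epsilon> + 1.
      ?x ^ (\<eta> - a) * (M $$ (a * m + r, b * n + c) * (?x ^ (\<epsilon> - b) * u $ c)))"
    using r entry_eq_pencil
    by (intro sum.cong refl) (simp add: x sum_distrib_right mult.assoc del: sum.op_ivl_Suc)
  also have "\<dots> = (\<Sum>a = 0..<\<eta> + 1. \<Sum>c = 0..<n. \<Sum>b = 0..<\<epsilon> + 1.
      ?x ^ (\<eta> - a) * (M $$ (a * m + r, b * n + c) * (?x ^ (\<epsilon> - b) * u $ c)))"
    by (rule sum.swap)
  also have "\<dots> = (\<Sum>a = 0..<\<eta> + 1. \<Sum>b = 0..<\<epsilon> + 1. \<Sum>c = 0..<n.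
      ?x ^ (\<eta> - a) * (M $$ (a * m + r, b * n + c) * (?x ^ (\<epsilon> - b) * u $ c)))"
    by (intro sum.cong refl sum.swap)
  also have "\<dots> = S y \<eta> r"
    by (intro sum.cong refl) (simp add: My sum_distrib_left del: sum.op_ivl_Suc)
  finally show ?thesis by simp
qed

lemma kernel_split:
  assumes "v \<in> mat_kernel \<L>"
  obtains y z where "v = y @\<^sub>v z" "y \<in> carrier_vec ((\<epsilon> + 1) * n)" "z \<in> carrier_vec (\<eta> * m)"
proof
  show "v = vec_first v ((\<epsilon> + 1) * n) @\<^sub>v vec_last v (\<eta> * m)"
    using mat_kernelD[OF L_carrier assms] by (simp only: vec_first_last_append)
qed auto

lemma proj_index:
  assumes "y \<in> carrier_vec ((\<epsilon> + 1) * n)" "c < n"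
  shows "proj (y @\<^sub>v z) $ c = y $ (\<epsilon> * n + c)"
  using assms by (simp add: select_coords_def)

lemma proj_bij: "bij_betw proj (mat_kernel \<L>) (mat_kernel P)"
  unfolding bij_betw_def
proof
  show "inj_on proj (mat_kernel \<L>)"
  proof (rule inj_onI)
    fix v v' assume v: "v \<in> mat_kernel \<L>" and v': "v' \<in> mat_kernel \<L>" and eq: "proj v = proj v'"
    obtain y z where yz: "v = y @\<^sub>v z" "y \<in> carrier_vec ((\<epsilon> + 1) * n)" "z \<in> carrier_vec (\<eta> * m)"
      using kernel_split[OF v] .
    obtain y' z' where yz': "v' = y' @\<^sub>v z'" "y' \<in> carrier_vec ((\<epsilon> + 1) * n)" "z' \<in> carrier_vec (\<eta> * m)"
      using kernel_split[OF v'] .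
    have ker_y: "\<And>a c. a \<le> \<epsilon> \<Longrightarrow> c < n \<Longrightarrow> y $ (a * n + c) = [:0, 1:] ^ (\<epsilon> - a) * y $ (\<epsilon> * n + c)"
      and ker_z: "\<And>a r. a < \<eta> \<Longrightarrow> r < m \<Longrightarrow> z $ (a * m + r) = S y a r"
      using v yz kernel_iff[OF yz(2,3)] by blast+
    have ker_y': "\<And>a c. a \<le> \<epsilon> \<Longrightarrow> c < n \<Longrightarrow> y' $ (a * n + c) = [:0, 1:] ^ (\<epsilon> - a) * y' $ (\<epsilon> * n + c)"
      and ker_z': "\<And>a r. a < \<eta> \<Longrightarrow> r < m \<Longrightarrow> z' $ (a * m + r) = S y' a r"
      using v' yz' kernel_iff[OF yz'(2,3)] by blast+
    have "\<forall>k<(\<epsilon> + 1) * n. y $ k = y' $ k"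
      unfolding all_block_index_iff
    proof (intro allI impI)
      fix a c assume ac: "a < \<epsilon> + 1" "c < n"
      have "y $ (\<epsilon> * n + c) = y' $ (\<epsilon> * n + c)"
        using eq proj_index[OF yz(2) ac(2), of z] proj_index[OF yz'(2) ac(2), of z'] yz yz' by simp
      then show "y $ (a * n + c) = y' $ (a * n + c)"
        using ker_y[of a c] ker_y'[of a c] ac by simp
    qed
    then have y: "y = y'"
      using yz yz' by (intro eq_vecI) auto
    have "\<forall>k<\<eta> * m. z $ k = z' $ k"
      unfolding all_block_index_iff
    proof (intro allI impI)
      fix a r assume ar: "a < \<eta>" "r < m"
      show "z $ (a * m + r) = z' $ (a * m + r)"
        by (simp only: ker_z[OF ar] ker_z'[OF ar] y)
    qed
    then have "z = z'"
      using yz yz' by (intro eq_vecI) auto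
    then show "v = v'" using y yz yz' by simp
  qed
  show "proj ` mat_kernel \<L> = mat_kernel P"
  proof (intro equalityI subsetI)
    fix u assume "u \<in> proj ` mat_kernel \<L>"
    then obtain v where v: "v \<in> mat_kernel \<L>" "u = proj v" by auto
    obtain y z where yz: "v = y @\<^sub>v z" "y \<in> carrier_vec ((\<epsilon> + 1) * n)" "z \<in> carrier_vec (\<eta> * m)"
      using kernel_split[OF v(1)] .
    have u: "u \<in> carrier_vec n" using v by (simp add: select_coords_def)
    have ker: "\<And>a c. a \<le> \<epsilon> \<Longrightarrow> c < n \<Longrightarrow> y $ (a * n + c) = [:0, 1:] ^ (\<epsilon> - a) * y $ (\<epsilon> * n + c)"
      "\<And>r. r < m \<Longrightarrow> S y \<eta> r = 0"
      using v yz kernel_iff[OF yz(2,3)] by blast+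
    have "P *\<^sub>v u = 0\<^sub>v m"
    proof (rule eq_vecI)
      fix r assume "r < dim_vec (0\<^sub>v m)"
      then have r: "r < m" by simp
      have "y $ (b * n + c) = [:0, 1:] ^ (\<epsilon> - b) * u $ c" if "b \<le> \<epsilon>" "c < n" for b c
        using ker(1)[OF that] proj_index[OF yz(2) that(2), of z] v yz by simp
      from S_top[OF yz(2) u this r] show "(P *\<^sub>v u) $ r = 0\<^sub>v m $ r"
        using ker(2)[OF r] r by simp
    qed (use P in simp)
    then show "u \<in> mat_kernel P"
      using u by (intro mat_kernelI[OF P])
  next
    fix u assume "u \<in> mat_kernel P"
    then have u: "u \<in> carrier_vec n" "P *\<^sub>v u = 0\<^sub>v m"
      using mat_kernelD[OF P] by auto
    \<comment> \<open>The only candidates that \<open>kernel_iff\<close> allows: powers of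
      \<open>x\<close> times \<open>u\<close>, and the Horner sums.\<close>
    define y where "y = vec ((\<epsilon> + 1) * n) (\<lambda>j. [:0, 1:] ^ (\<epsilon> - j div n) * u $ (j mod n))"
    define z where "z = vec (\<eta> * m) (\<lambda>j. S y (j div m) (j mod m))"
    have y: "y \<in> carrier_vec ((\<epsilon> + 1) * n)" and z: "z \<in> carrier_vec (\<eta> * m)"
      by (simp_all only: y_def z_def vec_carrier)
    have yu: "y $ (b * n + c) = [:0, 1:] ^ (\<epsilon> - b) * u $ c" if "b \<le> \<epsilon>" "c < n" for b c
      using block_index_less[OF that] that by (simp add: y_def)
    have "y @\<^sub>v z \<in> mat_kernel \<L>"
      unfolding kernel_iff[OF y z]
    proof (intro conjI allI impI)
      fix a c assume "a \<le> \<epsilon>" "c < n"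
      then show "y $ (a * n + c) = [:0, 1:] ^ (\<epsilon> - a) * y $ (\<epsilon> * n + c)"
        by (simp add: yu)
    next
      fix a r assume ar: "a < \<eta>" "r < m"
      then have "a * m + r < \<eta> * m"
        using block_index_less[of a "\<eta> - 1" r m] by simp
      then show "z $ (a * m + r) = S y a r"
        using ar by (simp add: z_def)
    next
      fix r assume r: "r < m"
      show "S y \<eta> r = 0"
        using S_top[OF y u(1) yu r] u(2) r by simp
    qed
    moreover have "proj (y @\<^sub>v z) = u"
    proof (rule eq_vecI)
      fix c assume "c < dim_vec u"
      then have "c < n" using u by simp
      then show "proj (y @\<^sub>v z) $ c = u $ c"
        by (simp only: proj_index[OF y] yu[OF order_refl]) simp
    qed (use u in \<open>simp add: select_coords_def\<close>)
    ultimately show "u \<in> proj ` mat_kernel \<L>" by blast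
  qed
qed

text \<open>Block 0 of \<open>y\<close> is \<open>x^\<epsilon> u\<close>, which gives the lower
  bound. For the upper bound the Horner formula for \<open>z\<close> is too coarse, as its powers of
  \<open>x\<close> could raise the degree further; instead the equations are solved from the last
  block upwards, which divides by \<open>x\<close>.\<close>

lemma proj_degree:
  assumes v: "v \<in> mat_kernel \<L>" "v \<noteq> 0\<^sub>v ((\<epsilon> + 1) * n + \<eta> * m)"
  shows "vec_degree v = vec_degree (proj v) + \<epsilon>"
proof -
  let ?x = "[:0, 1:] :: 'a poly" and ?u = "proj v" and ?D = "vec_degree (proj v) + \<epsilon>"
  have x: "?x ^ k = monom 1 k" for k
    by (simp add: monom_altdef)
  obtain y z where yz: "v = y @\<^sub>v z" "y \<in> carrier_vec ((\<epsilon> + 1) * n)" "z \<in> carrier_vec (\<eta> * m)"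
    using kernel_split[OF v(1)] .
  have dimu: "dim_vec ?u = n" by (simp add: select_coords_def)
  have dimv: "dim_vec v = (\<epsilon> + 1) * n + \<eta> * m" using yz by simp
  have yu: "y $ (a * n + c) = monom 1 (\<epsilon> - a) * ?u $ c" if "a \<le> \<epsilon>" "c < n" for a c
  proof -
    have "y $ (a * n + c) = ?x ^ (\<epsilon> - a) * y $ (\<epsilon> * n + c)"
      using v(1) yz(1) kernel_iff[OF yz(2,3)] that by blast
    then show ?thesis
      unfolding x[symmetric] using proj_index[OF yz(2) that(2), of z] yz(1) by simp
  qed
  have u0: "?u \<noteq> 0\<^sub>v n"
  proof
    assume "?u = 0\<^sub>v n"
    moreover have "proj (0\<^sub>v ((\<epsilon> + 1) * n + \<eta> * m) :: 'a poly vec) = 0\<^sub>v n"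
      by (rule eq_vecI) (auto simp: select_coords_def)
    moreover have "0\<^sub>v ((\<epsilon> + 1) * n + \<eta> * m) \<in> mat_kernel \<L>"
      using L_carrier by (intro mat_kernelI[OF L_carrier]) auto
    ultimately show False
      using v inj_onD[OF bij_betw_imp_inj_on[OF proj_bij], of v "0\<^sub>v ((\<epsilon> + 1) * n + \<eta> * m)"] by simp
  qed
  \<comment> \<open>A nonzero entry of maximal degree, so that multiplication by
    \<open>x^\<epsilon>\<close> raises its degree by exactly \<open>\<epsilon>\<close>; it also
    shows that \<open>n\<close> is positive.\<close>
  obtain c where c: "c < n" "?u $ c \<noteq> 0" "degree (?u $ c) = vec_degree ?u"
    using vec_degree_attained[of ?u] u0 dimu by auto
  have deg_y: "\<forall>j<(\<epsilon> + 1) * n. degree (y $ j) \<le> ?D"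
    unfolding all_block_index_iff
  proof (intro allI impI)
    fix a c assume ac: "a < \<epsilon> + 1" "c < n"
    have "degree (y $ (a * n + c)) \<le> degree (monom 1 (\<epsilon> - a) :: 'a poly) + degree (?u $ c)"
      using ac by (simp add: yu degree_mult_le)
    also have "\<dots> \<le> \<epsilon> + vec_degree ?u"
      using degree_le_vec_degree[of c ?u] dimu ac by (intro add_mono) (auto simp: degree_monom_eq)
    finally show "degree (y $ (a * n + c)) \<le> ?D" by simp
  qed
  have deg_My: "degree ((M *\<^sub>v y) $ i) \<le> ?D + 1" if i: "i < (\<eta> + 1) * m" for i
  proof -
    have "(M *\<^sub>v y) $ i = (\<Sum>j = 0..<(\<epsilon> + 1) * n. M $$ (i, j) * y $ j)"
      using M_carrier yz(2) i by (auto simp: scalar_prod_def)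
    also have "degree \<dots> \<le> ?D + 1"
    proof (rule degree_sum_le)
      fix j assume j: "j \<in> {0..<(\<epsilon> + 1) * n}"
      have "degree (M $$ (i, j)) \<le> 1"
        using i j M0 M1 by (auto simp: pencil_def)
      then have "degree (M $$ (i, j)) + degree (y $ j) \<le> 1 + ?D"
        using deg_y j by (intro add_mono) auto
      then show "degree (M $$ (i, j) * y $ j) \<le> ?D + 1"
        using degree_mult_le[of "M $$ (i, j)" "y $ j"] by linarith
    qed simp
    finally show ?thesis .
  qed
  have eqs: "(M *\<^sub>v y) $ (a * m + r) + (if a < \<eta> then - z $ (a * m + r) else 0)
      + (if 0 < a then [:0, 1:] * z $ ((a - 1) * m + r) else 0) = 0" if "a \<le> \<eta>" "r < m" for a r
    using v(1) yz(1) kernel_equations[OF yz(2,3)] that by blast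
  have deg_z: "\<forall>j<\<eta> * m. degree (z $ j) \<le> ?D"
    unfolding all_block_index_iff
  proof (intro allI impI)
    fix a r assume "a < \<eta>" and r: "r < m"
    \<comment> \<open>Descending in the block number: \<open>x\<close> times block \<open>a\<close>
      of \<open>z\<close> is block \<open>a + 1\<close> of \<open>z - M y\<close>, or of
      \<open>- M y\<close> at the end. That has degree at most \<open>?D + 1\<close>, and cancelling
      \<open>x\<close> gains the missing 1.\<close>
    from \<open>a < \<eta>\<close> show "degree (z $ (a * m + r)) \<le> ?D"
    proof (induction rule: strict_inc_induct)
      case (base a)
      have "(M *\<^sub>v y) $ (\<eta> * m + r) + ?x * z $ (a * m + r) = 0"
        using eqs[of \<eta> r] r base by auto
      then have "?x * z $ (a * m + r) = - (M *\<^sub>v y) $ (\<eta> * m + r)"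
        by (simp add: eq_neg_iff_add_eq_0 add.commute)
      then have "degree (?x * z $ (a * m + r)) \<le> ?D + 1"
        using deg_My[OF block_index_less[OF order_refl r]] by simp
      then show ?case
        by (cases "z $ (a * m + r) = 0") auto
    next
      case (step a)
      have "(M *\<^sub>v y) $ (Suc a * m + r) - z $ (Suc a * m + r) + ?x * z $ (a * m + r) = 0"
        using eqs[of "Suc a" r] r step by auto
      then have "?x * z $ (a * m + r) = z $ (Suc a * m + r) - (M *\<^sub>v y) $ (Suc a * m + r)"
        by (simp add: algebra_simps)
      moreover have "degree (z $ (Suc a * m + r) - (M *\<^sub>v y) $ (Suc a * m + r)) \<le> ?D + 1"
        using step deg_My[OF block_index_less[of "Suc a" \<eta> r m]] r by (intro degree_diff_le) auto
      ultimately have "degree (?x * z $ (a * m + r)) \<le> ?D + 1"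
        by simp
      then show ?case
        by (cases "z $ (a * m + r) = 0") auto
    qed
  qed
  show ?thesis
  proof (rule order.antisym)
    have "0 < n" using c by simp
    then show "vec_degree v \<le> ?D"
      using yz deg_y deg_z dimv by (intro vec_degree_leI) auto
    have "degree (y $ (0 * n + c)) = ?D"
      using c by (simp only: yu[OF le0]) (simp add: degree_mult_eq degree_monom_eq)
    moreover have "v $ c = y $ (0 * n + c)"
      using yz c by simp
    ultimately show "?D \<le> vec_degree v"
      using degree_le_vec_degree[of c v] c dimv by simp
  qed
qed

lemma right_minimal_indices_block_kronecker:
  "right_minimal_indices \<L> = map (\<lambda>\<alpha>. \<alpha> + \<epsilon>) (right_minimal_indices P)"
  by (rule right_minimal_indices_shift[OF P L_carrier _ proj_bij proj_degree]) auto

end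

section \<open>Left minimal indices by transposition\<close>

lemma left_null_space_eq: "left_null_space P = right_null_space (P\<^sup>T)"
proof -
  let ?A = "fract_mat P"
  have "mat_of_row y * ?A = 0\<^sub>m 1 (dim_col P) \<longleftrightarrow> ?A\<^sup>T *\<^sub>v y = 0\<^sub>v (dim_col P)"
    if y: "y \<in> carrier_vec (dim_row P)" for y
  proof -
    have "(mat_of_row y * ?A) $$ (0, j) = (?A\<^sup>T *\<^sub>v y) $ j" if "j < dim_col P" for j
      using that y by (simp add: comm_scalar_prod[of y "dim_row P"])
    then show ?thesis
      by (auto simp: mat_eq_iff vec_eq_iff)
  qed
  moreover have "fract_mat (P\<^sup>T) = ?A\<^sup>T"
    by (rule eq_matI) auto
  ultimately show ?thesis
    by (auto simp: left_null_space_def right_null_space_def mat_kernel_def)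
qed

lemma left_minimal_indices_eq: "left_minimal_indices P = right_minimal_indices (P\<^sup>T)"
  by (simp add: left_minimal_indices_def right_minimal_indices_def left_null_space_eq)

text \<open>The two borders trade places, and since exactly one of them contains a transposed
  \<open>L\<close>, the shape of the pencil is preserved.\<close>

lemma transpose_block_kronecker_pencil:
  assumes M0: "M0 \<in> carrier_mat ((\<eta> + 1) * m) ((\<epsilon> + 1) * n)"
    and M1: "M1 \<in> carrier_mat ((\<eta> + 1) * m) ((\<epsilon> + 1) * n)"
  shows "(block_kronecker_pencil \<epsilon> n \<eta> m M1 M0)\<^sup>T =
    block_kronecker_pencil \<eta> m \<epsilon> n (M1\<^sup>T) (M0\<^sup>T)"
proof -
  have "(block_kronecker_pencil \<epsilon> n \<eta> m M1 M0)\<^sup>T = four_block_mat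
    ((pencil M1 M0)\<^sup>T) ((L_pencil \<epsilon> \<otimes>\<^sub>k 1\<^sub>m n)\<^sup>T)
    (((L_pencil \<eta>)\<^sup>T \<otimes>\<^sub>k 1\<^sub>m m)\<^sup>T) ((0\<^sub>m (\<epsilon> * n) (\<eta> * m))\<^sup>T)"
    unfolding block_kronecker_pencil_def
    by (rule transpose_four_block_mat[of _ "(\<eta> + 1) * m" "(\<epsilon> + 1) * n" _ "\<eta> * m" _ "\<epsilon> * n"])
      (use M0 M1 in \<open>auto simp: pencil_def intro!: carrier_matI\<close>)
  also have "(pencil M1 M0)\<^sup>T = pencil (M1\<^sup>T) (M0\<^sup>T)"
    using M0 M1 by (intro eq_matI) (auto simp: pencil_def)
  finally show ?thesis
    by (simp add: block_kronecker_pencil_def kron_one_transpose)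
qed

text \<open>The condition \<open>i + j = t\<close> is symmetric in the block indices, so only the
  order of summation changes.\<close>

lemma antidiag_block_sum_transpose:
  assumes "M \<in> carrier_mat ((\<eta> + 1) * m) ((\<epsilon> + 1) * n)"
  shows "antidiag_block_sum \<eta> m \<epsilon> n (M\<^sup>T) t = (antidiag_block_sum \<epsilon> n \<eta> m M t)\<^sup>T"
proof (rule eq_matI, goal_cases)
  case (1 c r)
  then have rc: "r < m" "c < n"
    using antidiag_block_sum_carrier[of \<epsilon> n \<eta> m M t] by auto
  have "antidiag_block_sum \<eta> m \<epsilon> n (M\<^sup>T) t $$ (c, r) = (\<Sum>b = 0..<\<epsilon> + 1. \<Sum>a = 0..<\<eta> + 1.
      if a + b + 2 = t then M $$ (a * m + r, b * n + c) else 0)"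
    unfolding antidiag_block_sum_index[OF rc(2,1)]
  proof (intro sum.cong refl, goal_cases)
    case (1 b a)
    then have "a \<le> \<eta>" "b \<le> \<epsilon>" by auto
    then have "a * m + r < (\<eta> + 1) * m" "b * n + c < (\<epsilon> + 1) * n"
      using rc block_index_less by blast+
    then show ?case
      using assms by (simp add: add.commute)
  qed
  also have "\<dots> = antidiag_block_sum \<epsilon> n \<eta> m M t $$ (r, c)"
    unfolding antidiag_block_sum_index[OF rc] by (rule sum.swap)
  finally show ?case
    using rc antidiag_block_sum_carrier[of \<epsilon> n \<eta> m M t] by simp
qed (use antidiag_block_sum_carrier[of \<epsilon> n \<eta> m M t]
    antidiag_block_sum_carrier[of \<eta> m \<epsilon> n "M\<^sup>T" t] in auto)

text \<open>Turns the result on right minimal indices into the one on left minimal indices, with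
  shift \<open>\<eta>\<close> in place of \<open>\<epsilon>\<close>.\<close>

lemma block_kronecker_form_transpose:
  assumes "block_kronecker_form P M0 M1 m n d \<epsilon> \<eta>"
  shows "block_kronecker_form (P\<^sup>T) (M0\<^sup>T) (M1\<^sup>T) n m d \<eta> \<epsilon>"
proof -
  interpret block_kronecker_form P M0 M1 m n d \<epsilon> \<eta> by (rule assms)
  show ?thesis
  proof
    fix k assume "k \<le> d"
    have "antidiag_block_sum \<eta> m \<epsilon> n (M1\<^sup>T) (d + 2 - k) + antidiag_block_sum \<eta> m \<epsilon> n (M0\<^sup>T) (d + 1 - k)
      = (antidiag_block_sum \<epsilon> n \<eta> m M1 (d + 2 - k) + antidiag_block_sum \<epsilon> n \<eta> m M0 (d + 1 - k))\<^sup>T"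
      unfolding antidiag_block_sum_transpose[OF M0] antidiag_block_sum_transpose[OF M1]
      by (rule transpose_add[OF antidiag_block_sum_carrier antidiag_block_sum_carrier, symmetric])
    also have "\<dots> = coeff_mat (P\<^sup>T) k"
      unfolding antidiag[OF \<open>k \<le> d\<close>] by (rule eq_matI) (auto simp: coeff_mat_def)
    finally show "antidiag_block_sum \<eta> m \<epsilon> n (M1\<^sup>T) (d + 2 - k)
      + antidiag_block_sum \<eta> m \<epsilon> n (M0\<^sup>T) (d + 1 - k) = coeff_mat (P\<^sup>T) k" .
  qed (use P M0 M1 d has_grade_transpose[OF grade] in auto)
qed

theorem theorem4p4:
  fixes P :: "'a::field poly mat" and M0 M1 :: "'a mat" and m n d \<epsilon> \<eta> :: nat
  assumes "P \<in> carrier_mat m n"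
    and "has_grade d P"
    and "M0 \<in> carrier_mat ((\<eta> + 1) * m) ((\<epsilon> + 1) * n)"
    and "M1 \<in> carrier_mat ((\<eta> + 1) * m) ((\<epsilon> + 1) * n)"
    and "\<epsilon> + \<eta> + 1 = d"
    and "\<And>k. k \<le> d \<Longrightarrow>
      antidiag_block_sum \<epsilon> n \<eta> m M1 (d + 2 - k) + antidiag_block_sum \<epsilon> n \<eta> m M0 (d + 1 - k)
        = coeff_mat P k"
  shows "is_strong_linearization d (block_kronecker_pencil \<epsilon> n \<eta> m M1 M0) P \<and>
    right_minimal_indices (block_kronecker_pencil \<epsilon> n \<eta> m M1 M0)
      = map (\<lambda>\<alpha>. \<alpha> + \<epsilon>) (right_minimal_indices P) \<and>
    left_minimal_indices (block_kronecker_pencil \<epsilon> n \<eta> m M1 M0)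
      = map (\<lambda>\<alpha>. \<alpha> + \<eta>) (left_minimal_indices P)"
proof -
  have form: "block_kronecker_form P M0 M1 m n d \<epsilon> \<eta>"
    using assms by unfold_locales
  note left = block_kronecker_form.right_minimal_indices_block_kronecker
    [OF block_kronecker_form_transpose[OF form]]
  show ?thesis
    using block_kronecker_form.strong_linearization[OF form]
      block_kronecker_form.right_minimal_indices_block_kronecker[OF form] left
    by (simp add: left_minimal_indices_eq transpose_block_kronecker_pencil[OF assms(3,4)])
qed

end
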